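(* Let $d\ge 3$ be a fixed integer. Let the random $d$-regular graphs $H_2,H_4,H_6,\dots$ be chosen independently, and for even $n$ let $\Gamma_n$ be the sandpile group of $H_n$. Then with probability $1$, we have (along even $n$) $$\lim_{n\to\infty}\frac{\mathrm{Rank}(\Gamma_n)}{n}=0.$$
   Context: $H_n$ ($n$ even) is the union (with multiplicity) of $d$ independent uniform random perfect matchings of $\{1,\dots,n\}$, with adjacency matrix $C_n$. The reduced Laplacian $\Delta_n$ is obtained from $C_n-dI$ by deleting its last row and last column; $\Gamma_n=\mathbb{Z}^{n-1}/\mathrm{RowSpace}(\Delta_n)$, where $\mathrm{RowSpace}(\Delta_n)$ is the subgroup of $\mathbb{Z}^{n-1}$ generated by the rows of $\Delta_n$. The rank of a group is its minimum number of generators. *)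

theory Defs
  imports
    "HOL-Probability.Probability"
    "HOL-Library.Disjoint_Sets"
    "HOL-Algebra.Algebra"
    "Jordan_Normal_Form.Determinant"
begin

definition perfect_matchings :: "nat \<Rightarrow> nat set set set" where
  "perfect_matchings n = {M. partition_on {1..n} M \<and> (\<forall>e\<in>M. card e = 2)}"

lemma finite_perfect_matchings: "finite (perfect_matchings n)"
proof (rule finite_subset)
  show "perfect_matchings n \<subseteq> Pow (Pow {1..n})"
    by (auto simp: perfect_matchings_def partition_on_def)
qed auto

lemma perfect_matchings_nonempty:
  assumes "even n"
  shows "perfect_matchings n \<noteq> {}"
  using assms
proof (induction n rule: less_induct)
  case (less n)
  show ?case
  proof (cases "n = 0")
    case True
    then show ?thesis
      by (auto simp: perfect_matchings_def partition_on_empty)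
  next
    case False
    then obtain k where n: "n = k + 2" "even k"
      using less.prems by (intro that[of "n - 2"]) (presburger, simp)
    then have "perfect_matchings k \<noteq> {}"
      using less.IH by simp
    then obtain M where M: "partition_on {1..k} M" "\<forall>e\<in>M. card e = 2"
      unfolding perfect_matchings_def by blast
    have "\<Union>M = {1..k}"
      using partition_onD1[OF M(1)] by simp
    then have "disjnt {k + 1, k + 2} (\<Union>M)"
      by (simp add: disjnt_def)
    moreover have "{1..n} - {k + 1, k + 2} = {1..k}" "{k + 1, k + 2} \<subseteq> {1..n}"
      using n(1) by auto
    ultimately have "partition_on {1..n} (insert {k + 1, k + 2} M)"
      using M(1) by (simp add: partition_on_insert)
    moreover have "\<forall>e\<in>insert {k + 1, k + 2} M. card e = 2"
      using M(2) by simp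
    ultimately show ?thesis
      unfolding perfect_matchings_def by blast
  qed
qed

text \<open>
  A loopless multigraph on \<open>{1..n}\<close> is represented by its multiset of edges, an edge being
  a two-element set of vertices. The pmf below is the law of the union, with multiplicity,
  of \<open>d\<close> independent uniform perfect matchings. It is only meaningful for even \<open>n\<close>, since
  otherwise there are no perfect matchings.
\<close>

definition random_matching_graph :: "nat \<Rightarrow> nat \<Rightarrow> nat set multiset pmf" where
  "random_matching_graph d n =
     map_pmf (\<lambda>m. \<Sum>i<d. mset_set (m i))
       (Pi_pmf {..<d} {} (\<lambda>_. pmf_of_set (perfect_matchings n)))"

text \<open>
  Matrix indices start at 0, so vertex \<open>v\<close> corresponds to index \<open>v - 1\<close>.
\<close>

definition adjacency_matrix :: "nat \<Rightarrow> nat set multiset \<Rightarrow> int mat" where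
  "adjacency_matrix n H = Matrix.mat n n (\<lambda>(i, j). int (count H {Suc i, Suc j}))"

definition reduced_laplacian :: "nat \<Rightarrow> nat \<Rightarrow> nat set multiset \<Rightarrow> int mat" where
  "reduced_laplacian d n H =
     mat_delete (adjacency_matrix n H - int d \<cdot>\<^sub>m 1\<^sub>m n) (n - 1) (n - 1)"

definition row_subgroup :: "nat \<Rightarrow> int mat \<Rightarrow> int Matrix.vec set" where
  "row_subgroup m A = generate (monoid_vec TYPE(int) m) (set (Matrix.rows A))"

definition sandpile_group :: "nat \<Rightarrow> nat \<Rightarrow> nat set multiset \<Rightarrow> int Matrix.vec set monoid" where
  "sandpile_group d n H =
     monoid_vec TYPE(int) (n - 1) Mod row_subgroup (n - 1) (reduced_laplacian d n H)"

text \<open>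
  The minimum number of generators of a finitely generated group. (It is unspecified
  for groups that are not finitely generated; sandpile groups are quotients of
  \<open>\<int>\<^sup>m\<close> with \<open>m = n - 1\<close>.)
\<close>

definition group_rank :: "('a, 'b) monoid_scheme \<Rightarrow> nat" where
  "group_rank G =
     (LEAST k. \<exists>S. S \<subseteq> carrier G \<and> finite S \<and> card S = k \<and> generate G S = carrier G)"

end

theory Submission
  imports Defs "HOL-Real_Asymp.Real_Asymp"
begin

text \<open>
  Fix \<open>\<epsilon> > 0\<close>. By the Borel--Cantelli lemma it suffices that the probability of
  \<open>Rank(\<Gamma>\<^sub>n) > \<epsilon> n\<close> is summable over even \<open>n\<close>. The estimate has a deterministic half and a probabilistic half.

  The deterministic half (\<open>lattice_generators\<close>, \<open>group_rank_sandpile_le\<close>) bounds the rank by the sizes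
  of the kernels \<open>K\<^sub>p\<close> of \<open>C - dI\<close> modulo the finitely many primes \<open>p < c\<close>, for an arbitrary
  cutoff \<open>c \<ge> 3\<close>. Modulo \<open>p\<close>, the row lattice has index at most \<open>\<bar>K\<^sub>p\<bar>\<close>, so that at most \<open>log\<^sub>p \<bar>K\<^sub>p\<bar>\<close>
  unit vectors have to be added to obtain everything modulo \<open>p\<close>. When this has been done for all
  \<open>p < c\<close>, the enlarged lattice \<open>J\<close> contains vectors with bounded column sums that form a basis
  modulo 2; a volume argument then shows that its index is at most \<open>(4 d + 3)\<^sup>n\<close>. Moreover no
  prime below \<open>c\<close> divides the exponent of \<open>\<int>\<^sup>n\<^sup>-\<^sup>1 / J\<close>, so each further vector that is not yet in the
  lattice divides the index by at least \<open>c\<close>, and \<open>n log\<^sub>c (4 d + 3)\<close> further vectors suffice. For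
  large \<open>c\<close> this is at most \<open>\<epsilon> n / 2\<close>. Thus large primes are dealt with deterministically.

  The probabilistic half (\<open>sum_card_kernel_le\<close>) shows that \<open>E \<bar>K\<^sub>p\<bar>\<close> grows only polynomially in \<open>n\<close>.
  For a vector \<open>x\<close> modulo \<open>p\<close>, write \<open>M x\<close> for \<open>x\<close> permuted by the matching \<open>M\<close>. If all but two of
  the matchings are given, \<open>x \<in> K\<^sub>p\<close> is a condition \<open>M x + M' x = z\<close> on two independent
  matchings. By the Cauchy--Schwarz inequality its probability is at most that of \<open>M x = M' x\<close>.
  Summed over \<open>x\<close>, the latter probabilities give the expectation of \<open>p\<close> to the power of
  twice the number of components of \<open>M \<union> M'\<close>, since such an \<open>x\<close> is constant on the two
  alternating classes of every cycle. Exposing one edge of \<open>M'\<close> after the other evaluates this to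
  \<open>\<Prod>\<^sub>j (p\<^sup>2 + 2 j) / (2 j + 1)\<close> with \<open>j\<close> ranging below \<open>n / 2\<close> (\<open>card_agree_le\<close>, \<open>card_matchings_ge\<close>). Markov's
  inequality at the threshold \<open>2\<^sup>\<delta>\<^sup>n\<close> makes the probabilities of large kernels summable.
\<close>

section \<open>Pairs of perfect matchings\<close>

definition matchings :: "'v set \<Rightarrow> 'v set set set" where
  "matchings V = {M. partition_on V M \<and> (\<forall>e\<in>M. card e = 2)}"

lemma perfect_matchings_eq: "perfect_matchings n = matchings {1..n}"
  by (simp add: perfect_matchings_def matchings_def)

lemma finite_matchings: "finite V \<Longrightarrow> finite (matchings V)"
  by (rule finite_subset[of _ "Pow (Pow V)"])
     (auto simp: matchings_def partition_on_def)

lemma matchings_empty [simp]: "matchings {} = {{}}"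
  by (auto simp: matchings_def partition_on_empty)

lemma matching_edgeD:
  assumes "M \<in> matchings V" "{a, b} \<in> M"
  shows "a \<in> V" "b \<in> V" "a \<noteq> b"
proof -
  show "a \<in> V" "b \<in> V" using assms by (auto simp: matchings_def partition_on_def)
  have "card {a, b} = 2" using assms by (auto simp: matchings_def)
  then show "a \<noteq> b" by auto
qed

lemma matching_partner_ex:
  assumes "M \<in> matchings V" "a \<in> V"
  shows "\<exists>b. {a, b} \<in> M"
proof -
  obtain e where e: "e \<in> M" "a \<in> e"
    using assms by (auto simp: matchings_def partition_on_def)
  then have "card e = 2" using assms by (auto simp: matchings_def)
  then obtain x y where "e = {x, y}" by (auto simp: card_2_iff)
  with e show ?thesis by (auto simp: insert_commute)
qed

lemma matching_edge_unique:
  assumes "M \<in> matchings V" "e \<in> M" "f \<in> M" "a \<in> e" "a \<in> f"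
  shows "e = f"
  using assms disjointD[of M e f] by (auto simp: matchings_def partition_on_def)

lemma matching_partner_unique:
  assumes "M \<in> matchings V" "{a, b} \<in> M" "{a, c} \<in> M"
  shows "b = c"
  using matching_edge_unique[OF assms, of a] by (simp add: doubleton_eq_iff) blast

lemma matchings_insert:
  assumes "M \<in> matchings (V - {a, b})" "a \<in> V" "b \<in> V" "a \<noteq> b"
  shows "insert {a, b} M \<in> matchings V"
proof -
  have "disjnt {a, b} (\<Union>M)"
    using assms(1) by (auto simp: matchings_def partition_on_def disjnt_def)
  then show ?thesis
    using assms by (auto simp: matchings_def partition_on_insert)
qed

lemma matchings_remove:
  assumes "M \<in> matchings V" "{a, b} \<in> M"
  shows "M - {{a, b}} \<in> matchings (V - {a, b})"
proof -
  have "disjnt {a, b} (\<Union>(M - {{a, b}}))"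
    using matching_edge_unique[OF assms(1) _ assms(2), of _ a]
      matching_edge_unique[OF assms(1) _ assms(2), of _ b]
    by (simp add: disjnt_iff) blast
  moreover have "insert {a, b} (M - {{a, b}}) = M" using assms(2) by blast
  ultimately have "partition_on (V - {a, b}) (M - {{a, b}})"
    using partition_on_insert[of "{a, b}" "M - {{a, b}}" V] assms(1) by (simp add: matchings_def)
  then show ?thesis using assms(1) by (simp add: matchings_def)
qed

text \<open>
  A fixed vertex has \<open>2 k - 1\<close> possible partners, and each choice leaves a matching problem on two
  vertices fewer.
\<close>

lemma card_matchings_ge:
  assumes "finite V" "card V = 2 * k"
  shows "(\<Prod>j<k. 2 * j + 1) \<le> card (matchings V)"
  using assms
proof (induction k arbitrary: V)
  case 0
  then show ?case by simp
next
  case (Suc k)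
  then have "V \<noteq> {}" by auto
  then obtain v where v: "v \<in> V" by blast
  let ?S = "\<lambda>b. insert {v, b} ` matchings (V - {v, b})"
  have fin: "finite (matchings (V - {v, b}))" for b
    using Suc.prems by (intro finite_matchings) auto
  have sub: "(\<Union>b\<in>V - {v}. ?S b) \<subseteq> matchings V"
  proof (intro UN_least subsetI, elim imageE)
    fix b N M assume "b \<in> V - {v}" "N = insert {v, b} M" "M \<in> matchings (V - {v, b})"
    then show "N \<in> matchings V" using v matchings_insert[of M V v b] by auto
  qed
  have inj: "inj_on (insert {v, b}) (matchings (V - {v, b}))" for b
  proof (rule inj_onI)
    fix M N assume M: "M \<in> matchings (V - {v, b})" and N: "N \<in> matchings (V - {v, b})"
      and eq: "insert {v, b} M = insert {v, b} N"
    have "{v, b} \<notin> K" if "K \<in> matchings (V - {v, b})" for K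
    proof
      assume "{v, b} \<in> K"
      from matching_edgeD(1)[OF that this] show False by simp
    qed
    from insert_ident[OF this[OF M] this[OF N]] eq show "M = N" by (rule iffD1)
  qed
  have disj: "disjoint_family_on ?S (V - {v})"
    unfolding disjoint_family_on_def
  proof (intro ballI impI equals0I)
    fix b c L assume bc: "b \<in> V - {v}" "c \<in> V - {v}" "b \<noteq> c" and L: "L \<in> ?S b \<inter> ?S c"
    from L obtain K K' where "L = insert {v, b} K" "L = insert {v, c} K'" "K \<in> matchings (V - {v, b})"
      by (elim IntE imageE)
    moreover from this have "L \<in> matchings V"
      using matchings_insert[of K V v b] v bc(1) by auto
    ultimately have "L \<in> matchings V" "{v, b} \<in> L" "{v, c} \<in> L" by (metis insertI1)+
    then show False using matching_partner_unique[of L V v b c] bc(3) by simp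
  qed
  have "(\<Prod>j<Suc k. 2 * j + 1) = (\<Sum>b\<in>V - {v}. (\<Prod>j<k. 2 * j + 1))"
    using Suc.prems v by simp
  also have "\<dots> \<le> (\<Sum>b\<in>V - {v}. card (?S b))"
  proof (rule sum_mono)
    fix b assume b: "b \<in> V - {v}"
    then have "card (V - {v, b}) = 2 * k"
      using Suc.prems v card_Diff_subset[of "{v, b}" V] by auto
    then have "(\<Prod>j<k. 2 * j + 1) \<le> card (matchings (V - {v, b}))"
      using Suc.IH Suc.prems by simp
    then show "(\<Prod>j<k. 2 * j + 1) \<le> card (?S b)"
      using inj by (simp add: card_image)
  qed
  also have "\<dots> = card (\<Union>b\<in>V - {v}. ?S b)"
    using Suc.prems fin disj by (subst card_UN_disjoint') auto
  also have "\<dots> \<le> card (matchings V)"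
    using Suc.prems sub by (intro card_mono finite_matchings)
  finally show ?case .
qed

text \<open>
  Writing \<open>\<lambda>\<close> and \<open>\<mu>\<close> for the involutions that \<open>L\<close> and \<open>M\<close> define, this says \<open>x \<circ> \<lambda> = x \<circ> \<mu>\<close>. The
  formulation by edges makes the surgery on matchings below a matter of set operations.
\<close>

definition agree :: "'v set set \<Rightarrow> 'v set set \<Rightarrow> ('v \<Rightarrow> 'c) \<Rightarrow> bool" where
  "agree L M x \<longleftrightarrow> (\<forall>v a b. {v, a} \<in> L \<longrightarrow> {v, b} \<in> M \<longrightarrow> x a = x b)"

lemma agreeD: "agree L M x \<Longrightarrow> {v, a} \<in> L \<Longrightarrow> {v, b} \<in> M \<Longrightarrow> x a = x b"
  unfolding agree_def by blast

lemma agree_restrict: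
  assumes "L \<in> matchings W" "M \<in> matchings W"
    and "\<And>u a b. {u, a} \<in> L \<Longrightarrow> {u, b} \<in> M \<Longrightarrow> x a = x b"
  shows "agree L M (restrict x W)"
  unfolding agree_def
proof (intro allI impI)
  fix u a b assume ab: "{u, a} \<in> L" "{u, b} \<in> M"
  show "restrict x W a = restrict x W b"
    using assms(3)[OF ab] matching_edgeD(2)[OF assms(1) ab(1)] matching_edgeD(2)[OF assms(2) ab(2)]
    by simp
qed

lemma restrict_eqD: "restrict x A = restrict y A \<Longrightarrow> u \<in> A \<Longrightarrow> x u = y u"
  by (metis restrict_apply')

text \<open>
  Expose the partner \<open>b\<close> of a vertex \<open>v\<close> in the variable matching \<open>M\<close>, and let \<open>a\<close> be its partner in
  the fixed matching \<open>L\<close>. If \<open>b = a\<close>, the edge closes a cycle of \<open>L \<union> M\<close>: the values \<open>x v\<close> and \<open>x a\<close> are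
  free, whence the factor \<open>(card F)\<^sup>2\<close>. Otherwise let \<open>c\<close> be the partner of \<open>b\<close> in \<open>L\<close>. The path
  \<open>a - v - b - c\<close> can be contracted to a single edge \<open>{a, c}\<close> of \<open>L\<close>; agreement forces \<open>x v = x c\<close> and
  \<open>x b = x a\<close>, so nothing is lost, and it is inherited by the contracted matchings. Each of the
  remaining choices of \<open>b\<close>, two fewer than there are vertices, therefore contributes at most the
  count for two vertices fewer.
\<close>

lemma card_agree_le:
  assumes "finite V" "card V = 2 * k" "L \<in> matchings V" "finite F"
  shows "card {(M, x). M \<in> matchings V \<and> x \<in> V \<rightarrow>\<^sub>E F \<and> agree L M x}
           \<le> (\<Prod>j<k. (card F)\<^sup>2 + 2 * j)"
  using assms
proof (induction k arbitrary: V L)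
  case 0
  then have "V = {}" by simp
  then have "{(M, x). M \<in> matchings V \<and> x \<in> V \<rightarrow>\<^sub>E F \<and> agree L M x} \<subseteq> {({}, \<lambda>_. undefined)}"
    by auto
  from card_mono[OF _ this] show ?case by simp
next
  case (Suc k)
  define S where "S V L = {(M, x). M \<in> matchings V \<and> x \<in> V \<rightarrow>\<^sub>E F \<and> agree L M x}" for V :: "'a set" and L
  have fin: "finite (S V L)" if "finite V" for V L
    by (rule finite_subset[of _ "matchings V \<times> (V \<rightarrow>\<^sub>E F)"])
       (use that finite_matchings Suc.prems in \<open>auto simp: S_def intro!: finite_PiE\<close>)
  define g where "g = (\<Prod>j<k. (card F)\<^sup>2 + 2 * j)"
  have IH: "card (S V L) \<le> g" if "finite V" "card V = 2 * k" "L \<in> matchings V" for V L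
    using Suc.IH[OF that] Suc.prems by (simp add: S_def g_def)
  obtain v where v: "v \<in> V" using Suc.prems by fastforce
  obtain a where a: "{v, a} \<in> L" using matching_partner_ex[OF Suc.prems(3) v] by blast
  note av = matching_edgeD[OF Suc.prems(3) a]
  define T where "T b = {(M, x) \<in> S V L. {v, b} \<in> M}" for b
  have cardV: "card (V - {v, b}) = 2 * k" "finite (V - {v, b})" if "b \<in> V - {v}" for b
    using that Suc.prems v card_Diff_subset[of "{v, b}" V] by auto
  have S_sub: "S V L \<subseteq> (\<Union>b\<in>V - {v}. T b)"
  proof
    fix z assume z: "z \<in> S V L"
    then obtain M x where Mx: "z = (M, x)" "M \<in> matchings V" by (auto simp: S_def)
    obtain b where b: "{v, b} \<in> M" using matching_partner_ex[OF Mx(2) v] by blast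
    then have "b \<in> V - {v}" using matching_edgeD[OF Mx(2) b] by simp
    moreover have "z \<in> T b" using z b Mx(1) by (simp add: T_def)
    ultimately show "z \<in> (\<Union>b\<in>V - {v}. T b)" by blast
  qed
  have Ta: "card (T a) \<le> (card F)\<^sup>2 * g"
  proof -
    let ?h = "\<lambda>(M, x). ((x v, x a), (M - {{v, a}}, restrict x (V - {v, a})))"
    have "inj_on ?h (T a)"
    proof (rule inj_onI, clarsimp)
      fix M x N y assume A: "(M, x) \<in> T a" "(N, y) \<in> T a" "x v = y v" "x a = y a"
        "M - {{v, a}} = N - {{v, a}}" "restrict x (V - {v, a}) = restrict y (V - {v, a})"
      have "{v, a} \<in> M" "{v, a} \<in> N" using A(1,2) by (simp_all add: T_def)
      then have "M = N" using A(5) by (metis insert_Diff)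
      moreover have "x = y"
      proof (rule PiE_ext)
        show "x \<in> V \<rightarrow>\<^sub>E F" "y \<in> V \<rightarrow>\<^sub>E F" using A(1,2) by (simp_all add: T_def S_def)
        fix u assume "u \<in> V" then show "x u = y u"
          using A(3,4) restrict_eqD[OF A(6), of u] by blast
      qed
      ultimately show "M = N \<and> x = y" by simp
    qed
    moreover have "?h ` T a \<subseteq> (F \<times> F) \<times> S (V - {v, a}) (L - {{v, a}})"
    proof
      fix z assume "z \<in> ?h ` T a"
      then obtain w where w: "z = ?h w" "w \<in> T a" by (rule imageE)
      obtain M x where "w = (M, x)" by (cases w)
      with w have z: "z = ?h (M, x)" and Mx: "(M, x) \<in> T a" by simp_all
      then have M: "M \<in> matchings V" "{v, a} \<in> M" and x: "x \<in> V \<rightarrow>\<^sub>E F" and ag: "agree L M x"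
        by (auto simp: T_def S_def)
      have "agree (L - {{v, a}}) (M - {{v, a}}) (restrict x (V - {v, a}))"
        by (intro agree_restrict matchings_remove Suc.prems a M) (use agreeD[OF ag] in blast)
      moreover have "M - {{v, a}} \<in> matchings (V - {v, a})" by (rule matchings_remove[OF M])
      moreover have "restrict x (V - {v, a}) \<in> (V - {v, a}) \<rightarrow>\<^sub>E F"
        using PiE_mem[OF x] by auto
      ultimately show "z \<in> (F \<times> F) \<times> S (V - {v, a}) (L - {{v, a}})"
        using PiE_mem[OF x av(1)] PiE_mem[OF x av(2)] by (simp add: z S_def)
    qed
    ultimately have "card (T a) \<le> card ((F \<times> F) \<times> S (V - {v, a}) (L - {{v, a}}))"
      using fin Suc.prems by (intro card_inj_on_le) auto
    also have "\<dots> \<le> (card F)\<^sup>2 * g"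
      using IH[OF cardV(2,1)] matchings_remove[OF Suc.prems(3) a] av
      by (auto simp: card_cartesian_product power2_eq_square)
    finally show ?thesis .
  qed
  have Tb: "card (T b) \<le> g" if b: "b \<in> V - {v}" "b \<noteq> a" for b
  proof -
    obtain c where c: "{b, c} \<in> L" using matching_partner_ex[OF Suc.prems(3)] b by blast
    note bc = matching_edgeD[OF Suc.prems(3) c]
    have "{a, v} \<in> L" "{c, b} \<in> L" using a c by (simp_all add: insert_commute)
    then have c_ne: "c \<noteq> v" "c \<noteq> a"
      using matching_partner_unique[OF Suc.prems(3) a, of b]
        matching_partner_unique[OF Suc.prems(3), of a v b] b by blast+
    \<comment> \<open>the contraction of the path with edges \<open>{a, v}\<close>, \<open>{v, b}\<close> and \<open>{b, c}\<close>\<close>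
    let ?L = "insert {a, c} (L - {{v, a}} - {{b, c}})"
    have L': "?L \<in> matchings (V - {v, b})"
    proof (rule matchings_insert)
      have "{b, c} \<in> L - {{v, a}}" using c b by (simp add: doubleton_eq_iff)
      from matchings_remove[OF matchings_remove[OF Suc.prems(3) a] this]
      moreover have "V - {v, a} - {b, c} = V - {v, b} - {a, c}" by blast
      ultimately show "L - {{v, a}} - {{b, c}} \<in> matchings (V - {v, b} - {a, c})" by simp
    qed (use av bc b c_ne in auto)
    let ?h = "\<lambda>(M, x). (M - {{v, b}}, restrict x (V - {v, b}))"
    have xab: "x a = x b" "x v = x c" if "(M, x) \<in> T b" for M x
    proof -
      have ag: "agree L M x" "{v, b} \<in> M" using that by (auto simp: T_def S_def)
      show "x a = x b" by (rule agreeD[OF ag(1) a ag(2)])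
      show "x v = x c" by (rule agreeD[OF ag(1), of b c v, symmetric]) (use ag(2) c in \<open>simp_all add: insert_commute\<close>)
    qed
    have "inj_on ?h (T b)"
    proof (rule inj_onI, clarsimp)
      fix M x N y assume A: "(M, x) \<in> T b" "(N, y) \<in> T b" 
        "M - {{v, b}} = N - {{v, b}}" "restrict x (V - {v, b}) = restrict y (V - {v, b})"
      have "{v, b} \<in> M" "{v, b} \<in> N" using A(1,2) by (simp_all add: T_def)
      then have "M = N" using A(3) by (metis insert_Diff)
      moreover have "x = y"
      proof (rule PiE_ext)
        show "x \<in> V \<rightarrow>\<^sub>E F" "y \<in> V \<rightarrow>\<^sub>E F" using A(1,2) by (simp_all add: T_def S_def)
        have eq: "x u = y u" if "u \<in> V - {v, b}" for u
          using restrict_eqD[OF A(4)] that .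
        fix u assume "u \<in> V" then show "x u = y u"
          using eq[of u] eq[of a] eq[of c] xab[OF A(1)] xab[OF A(2)] av bc b c_ne
          by (cases "u = v \<or> u = b") auto
      qed
      ultimately show "M = N \<and> x = y" by simp
    qed
    moreover have "?h ` T b \<subseteq> S (V - {v, b}) ?L"
    proof
      fix z assume "z \<in> ?h ` T b"
      then obtain w where w: "z = ?h w" "w \<in> T b" by (rule imageE)
      obtain M x where "w = (M, x)" by (cases w)
      with w have z: "z = ?h (M, x)" and Mx: "(M, x) \<in> T b" by simp_all
      then have M: "M \<in> matchings V" "{v, b} \<in> M" and x: "x \<in> V \<rightarrow>\<^sub>E F" and ag: "agree L M x"
        by (auto simp: T_def S_def)
      have M': "M - {{v, b}} \<in> matchings (V - {v, b})" by (rule matchings_remove[OF M])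
      have "x r = x s" if rs: "{u, r} \<in> ?L" "{u, s} \<in> M - {{v, b}}" for u r s
      proof (cases "{u, r} = {a, c}")
        case True
        have sM: "{u, s} \<in> M" using rs by simp
        have "x s = x v" if "u = a"
          using agreeD[OF ag, of a v s] sM a that by (simp add: insert_commute)
        moreover have "x s = x b" if "u = c"
          using agreeD[OF ag, of c b s] sM c that by (simp add: insert_commute)
        ultimately show ?thesis using True xab[OF Mx] by (auto simp: doubleton_eq_iff)
      next
        case False
        then have "{u, r} \<in> L" "{u, s} \<in> M" using rs by simp_all
        then show ?thesis by (rule agreeD[OF ag])
      qed
      then have "agree ?L (M - {{v, b}}) (restrict x (V - {v, b}))"
        by (intro agree_restrict L' M')
      moreover have "restrict x (V - {v, b}) \<in> (V - {v, b}) \<rightarrow>\<^sub>E F"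
        using PiE_mem[OF x] by auto
      ultimately show "z \<in> S (V - {v, b}) ?L"
        using M' by (simp add: z S_def)
    qed
    ultimately have "card (T b) \<le> card (S (V - {v, b}) ?L)"
      using fin Suc.prems by (intro card_inj_on_le) auto
    also have "\<dots> \<le> g" using IH[OF cardV(2,1) L'] b by blast
    finally show ?thesis .
  qed
  have finT: "finite (T b)" for b
    by (rule finite_subset[OF _ fin[OF Suc.prems(1), of L]]) (auto simp: T_def)
  have "card (S V L) \<le> card (\<Union>b\<in>V - {v}. T b)"
    using S_sub finT Suc.prems by (intro card_mono) auto
  also have "\<dots> \<le> (\<Sum>b\<in>V - {v}. card (T b))"
    using Suc.prems by (intro card_UN_le) auto
  also have "\<dots> = card (T a) + (\<Sum>b\<in>V - {v} - {a}. card (T b))"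
    using Suc.prems av by (intro sum.remove) auto
  also have "\<dots> \<le> (card F)\<^sup>2 * g + (\<Sum>b\<in>V - {v} - {a}. g)"
    using Ta Tb by (intro add_mono sum_mono) auto
  also have "\<dots> = (\<Prod>j<Suc k. (card F)\<^sup>2 + 2 * j)"
    using Suc.prems av by (simp add: g_def algebra_simps)
  finally show ?case by (simp add: S_def)
qed

section \<open>Subgroups of abelian groups and their index\<close>

context comm_group
begin

text \<open>
  A substitute for the index: for a subgroup \<open>J\<close>, these are the sets of elements in pairwise distinct
  cosets, so that a bound on the size of all finite ones bounds the index of \<open>J\<close>. In this form
  index estimates are injectivity statements inside the group itself, without quotients.
\<close>

definition separated :: "'a set \<Rightarrow> 'a set \<Rightarrow> bool" where
  "separated J R \<longleftrightarrow> R \<subseteq> carrier G \<and> (\<forall>x\<in>R. \<forall>y\<in>R. x \<otimes> inv y \<in> J \<longrightarrow> x = y)"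

lemma separatedD: "separated J R \<Longrightarrow> x \<in> R \<Longrightarrow> y \<in> R \<Longrightarrow> x \<otimes> inv y \<in> J \<Longrightarrow> x = y"
  unfolding separated_def by blast

lemma coset_diff:
  assumes "r \<in> carrier G" "s \<in> carrier G" "u \<in> carrier G" "v \<in> carrier G"
  shows "(r \<otimes> u) \<otimes> inv (s \<otimes> v) = (r \<otimes> inv s) \<otimes> (u \<otimes> inv v)"
  using assms by (simp add: inv_mult m_ac)

text \<open>
  If \<open>e\<close> has order at least \<open>c\<close> modulo \<open>J\<close>, adjoining \<open>e\<close> to \<open>J\<close> divides the index by at least \<open>c\<close>:
  the products of coset representatives with \<open>1, e, \<dots>, e\<^sup>c\<^sup>-\<^sup>1\<close> lie in distinct cosets of \<open>J\<close>.
\<close>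

lemma separated_extend:
  assumes J: "subgroup J G" and e: "e \<in> carrier G"
    and no_pow: "\<And>i. 0 < i \<Longrightarrow> i < c \<Longrightarrow> e [^] (i::nat) \<notin> J"
    and R: "separated (generate G (insert e J)) R" and "finite R"
  shows "\<exists>R'. separated J R' \<and> finite R' \<and> card R' = c * card R"
proof -
  let ?f = "\<lambda>(r, i::nat). r \<otimes> e [^] i"
  let ?R' = "?f ` (R \<times> {..<c})"
  have Rc: "R \<subseteq> carrier G" using R by (simp add: separated_def)
  have JG: "J \<subseteq> carrier G" by (rule subgroup.subset[OF J])
  have H: "subgroup (generate G (insert e J)) G"
    using generate_is_subgroup e JG by simp
  have eH: "e [^] (i::nat) \<in> generate G (insert e J)" for i
  proof (induction i)
    case 0
    then show ?case by (simp add: generate.one)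
  next
    case (Suc i)
    have "e \<in> generate G (insert e J)" by (rule generate.incl) simp
    with Suc show ?case by (simp add: generate.eng)
  qed
  have JH: "J \<subseteq> generate G (insert e J)" using generate.incl[of _ "insert e J"] by blast
  have pow: "i \<le> j" if "e [^] i \<otimes> inv (e [^] j) \<in> J" "i < c" for i j
  proof (rule ccontr)
    assume "\<not> i \<le> j"
    then have "e [^] i = e [^] (i - j) \<otimes> e [^] j" using e by (simp add: nat_pow_mult)
    then have "e [^] i \<otimes> inv (e [^] j) = e [^] (i - j)" using e by (simp add: m_assoc)
    then show False using that no_pow[of "i - j"] \<open>\<not> i \<le> j\<close> by simp
  qed
  have key: "r = s \<and> i = j"
    if rs: "r \<in> R" "s \<in> R" "i < c" "j < c" and inJ: "(r \<otimes> e [^] i) \<otimes> inv (s \<otimes> e [^] j) \<in> J" for r s i j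
  proof -
    have cl: "r \<in> carrier G" "s \<in> carrier G" using rs Rc by auto
    have eq: "(r \<otimes> e [^] i) \<otimes> inv (s \<otimes> e [^] j) = (r \<otimes> inv s) \<otimes> (e [^] i \<otimes> inv (e [^] j))"
      using cl e by (intro coset_diff) auto
    have "e [^] i \<otimes> inv (e [^] j) \<in> generate G (insert e J)"
      using eH H by (meson subgroup.m_closed subgroup.m_inv_closed)
    moreover have "(r \<otimes> inv s) \<otimes> (e [^] i \<otimes> inv (e [^] j)) \<in> generate G (insert e J)"
      using inJ JH eq by auto
    ultimately have "(r \<otimes> inv s) \<otimes> (e [^] i \<otimes> inv (e [^] j)) \<otimes> inv (e [^] i \<otimes> inv (e [^] j))
        \<in> generate G (insert e J)"
      using H by (meson subgroup.m_closed subgroup.m_inv_closed)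
    then have "r \<otimes> inv s \<in> generate G (insert e J)"
      using cl e by (simp add: m_assoc)
    then have "r = s" using separatedD[OF R] rs by blast
    with inJ eq cl e have ij: "e [^] i \<otimes> inv (e [^] j) \<in> J" by simp
    then have "inv (e [^] i \<otimes> inv (e [^] j)) \<in> J" by (rule subgroup.m_inv_closed[OF J])
    then have "e [^] j \<otimes> inv (e [^] i) \<in> J" using e by (simp add: inv_mult m_comm)
    with ij pow rs have "i = j" by (meson antisym)
    with \<open>r = s\<close> show ?thesis by simp
  qed
  have "inj_on ?f (R \<times> {..<c})"
  proof (rule inj_onI)
    fix a b assume ab: "a \<in> R \<times> {..<c}" "b \<in> R \<times> {..<c}" "?f a = ?f b"
    obtain r i s j where rs: "a = (r, i)" "b = (s, j)" by (metis surj_pair)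
    then have A: "r \<in> R" "i < c" "s \<in> R" "j < c" and eq: "r \<otimes> e [^] i = s \<otimes> e [^] j"
      using ab by auto
    have "(r \<otimes> e [^] i) \<otimes> inv (s \<otimes> e [^] j) = \<one>"
      unfolding eq using A Rc e by (intro r_inv) auto
    then show "a = b" using key[of r s i j] A rs subgroup.one_closed[OF J] by simp
  qed
  then have "card ?R' = c * card R" by (simp add: card_image card_cartesian_product)
  moreover have "separated J ?R'"
    unfolding separated_def
  proof (intro conjI ballI impI)
    show "?R' \<subseteq> carrier G" using Rc e by auto
    fix x y assume "x \<in> ?R'" "y \<in> ?R'" and xy: "x \<otimes> inv y \<in> J"
    then obtain r i s j where "x = r \<otimes> e [^] i" "y = s \<otimes> e [^] j" "r \<in> R" "s \<in> R" "i < c" "j < c"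
      by auto
    with key xy show "x = y" by blast
  qed
  ultimately show ?thesis using \<open>finite R\<close> by blast
qed

lemma pow_in_subgroup_cancel:
  assumes J: "subgroup J G" and e: "e \<in> carrier G"
    and "e [^] (N::nat) \<in> J" "e [^] (i::nat) \<in> J" "coprime i N"
  shows "e \<in> J"
proof -
  obtain u v where uv: "u * int i + v * int N = 1"
    using bezout_int[of "int i" "int N"] assms(5) by (metis coprime_imp_gcd_eq_1 coprime_int_iff)
  have "e [^] (u * int i + v * int N) = (e [^] i) [^] u \<otimes> (e [^] N) [^] v"
    using e by (simp add: int_pow_mult int_pow_pow[symmetric] int_pow_int mult.commute[of u] mult.commute[of v])
  moreover have "(e [^] i) [^] u \<in> J" "(e [^] N) [^] v \<in> J"
    using assms subgroup_int_pow_closed[OF J] by auto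
  ultimately show ?thesis using uv e subgroup.m_closed[OF J] by (metis int_pow_1)
qed

lemma generate_insert_generate:
  assumes "A \<subseteq> carrier G" "e \<in> carrier G"
  shows "generate G (insert e (generate G A)) = generate G (insert e A)"
proof (rule equalityI)
  have "generate G A \<subseteq> generate G (insert e A)" by (rule mono_generate) blast
  moreover have "e \<in> generate G (insert e A)" by (rule generate.incl) simp
  ultimately show "generate G (insert e (generate G A)) \<subseteq> generate G (insert e A)"
    using assms by (intro generate_subgroup_incl generate_is_subgroup) auto
  show "generate G (insert e A) \<subseteq> generate G (insert e (generate G A))"
    using generate.incl[of _ A] by (intro mono_generate) blast
qed

text \<open>
  Adjoin elements of \<open>E\<close> greedily. By the hypotheses on \<open>N\<close>, modulo the subgroup generated by
  \<open>K\<close> the order of every element of \<open>E\<close> divides \<open>N\<close>, and \<open>N\<close> has no prime factor below \<open>c\<close>; an element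
  of \<open>E\<close> outside the current subgroup therefore has order at least \<open>c\<close>, and each step divides the index by at least
  \<open>c\<close>. The lemma is applied with \<open>c = N\<close> prime, and with \<open>c\<close> a cutoff that no prime factor
  of \<open>N\<close> undercuts.
\<close>

lemma short_generating_set:
  assumes K: "K \<subseteq> carrier G" and E: "E \<subseteq> carrier G" "finite E"
    and gen: "generate G (K \<union> E) = carrier G"
    and N: "\<And>x. x \<in> E \<Longrightarrow> x [^] (N::nat) \<in> generate G K"
    and cop: "\<And>i. 0 < i \<Longrightarrow> i < c \<Longrightarrow> coprime i N"
    and bound: "\<And>R. separated (generate G K) R \<Longrightarrow> finite R \<Longrightarrow> card R \<le> t"
  shows "\<exists>T\<subseteq>E. generate G (K \<union> T) = carrier G \<and> c ^ card T \<le> t"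
proof -
  define P where "P T \<longleftrightarrow> T \<subseteq> E \<and>
    (\<forall>R. separated (generate G (K \<union> T)) R \<longrightarrow> finite R \<longrightarrow> 
      (\<exists>R'. separated (generate G K) R' \<and> finite R' \<and> card R' = c ^ card T * card R))" for T
  have "P {}" unfolding P_def by auto
  moreover have "card T \<le> card E" if "P T" for T
    using that E(2) by (auto simp: P_def intro: card_mono)
  ultimately obtain T where T: "P T" and max: "\<And>T'. P T' \<Longrightarrow> card T' \<le> card T"
    using ex_has_greatest_nat[of P "{}" card "Suc (card E)"] by (auto simp: less_Suc_eq_le)
  have TE: "T \<subseteq> E" using T by (simp add: P_def)
  have KT: "K \<union> T \<subseteq> carrier G" using K TE E by blast
  note J = generate_is_subgroup[OF KT]
  have "E \<subseteq> generate G (K \<union> T)"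
  proof (rule ccontr)
    assume "\<not> E \<subseteq> generate G (K \<union> T)"
    then obtain e where e: "e \<in> E" "e \<notin> generate G (K \<union> T)" by blast
    have eG: "e \<in> carrier G" using e E by blast
    have "e \<notin> T" using e generate.incl[of e "K \<union> T"] by blast
    have fT: "finite T" using TE E(2) finite_subset by blast
    have KJ: "generate G K \<subseteq> generate G (K \<union> T)" by (rule mono_generate) simp
    have no: "e [^] i \<notin> generate G (K \<union> T)" if "0 < i" "i < c" for i :: nat
      using pow_in_subgroup_cancel[OF J eG _ _ cop[OF that]] N[OF e(1)] KJ e(2) by blast
    have "P (insert e T)"
      unfolding P_def
    proof (intro conjI allI impI)
      show "insert e T \<subseteq> E" using e TE by blast
      fix R assume "separated (generate G (K \<union> insert e T)) R" "finite R"
      then have "separated (generate G (insert e (generate G (K \<union> T)))) R"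
        using generate_insert_generate[OF KT eG] by simp
      from separated_extend[OF J eG no this \<open>finite R\<close>]
      obtain R1 where R1: "separated (generate G (K \<union> T)) R1" "finite R1" "card R1 = c * card R"
        by blast
      with T obtain R' where "separated (generate G K) R'" "finite R'" "card R' = c ^ card T * card R1"
        unfolding P_def by blast
      with R1 \<open>e \<notin> T\<close> fT
      show "\<exists>R'. separated (generate G K) R' \<and> finite R' \<and> card R' = c ^ card (insert e T) * card R"
        by (intro exI[of _ R']) simp
    qed
    from max[OF this] \<open>e \<notin> T\<close> fT show False by simp
  qed
  then have "generate G (K \<union> E) \<subseteq> generate G (K \<union> T)"
    using generate.incl[of _ "K \<union> T"] by (intro generate_subgroup_incl J) blast
  then have "generate G (K \<union> T) = carrier G"
    using gen generate_incl[OF KT] by blast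
  moreover have "c ^ card T \<le> t"
  proof -
    have "separated (generate G (K \<union> T)) {\<one>}" by (simp add: separated_def)
    with T obtain R' where "separated (generate G K) R'" "finite R'" "card R' = c ^ card T * card {\<one>}"
      unfolding P_def by blast
    with bound[of R'] show ?thesis by simp
  qed
  ultimately show ?thesis using TE by blast
qed

text \<open>
  Two of the powers \<open>1, e, \<dots>, e\<^sup>t\<close> lie in the same coset, so \<open>e\<close> has order at most \<open>t\<close>
  modulo \<open>J\<close>.
\<close>

lemma finite_index_exponent:
  assumes J: "subgroup J G"
    and bound: "\<And>R. separated J R \<Longrightarrow> finite R \<Longrightarrow> card R \<le> t"
    and e: "e \<in> carrier G"
  shows "e [^] (fact t :: nat) \<in> J"
proof -
  have "\<exists>i j::nat. i < j \<and> j \<le> t \<and> e [^] j \<otimes> inv (e [^] i) \<in> J"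
  proof (rule ccontr)
    assume no: "\<not> ?thesis"
    have inv_mem: "e [^] j \<otimes> inv (e [^] i) \<in> J" if "e [^] i \<otimes> inv (e [^] j) \<in> J" for i j :: nat
    proof -
      from subgroup.m_inv_closed[OF J that] show ?thesis using e by (simp add: inv_mult m_comm)
    qed
    have eq: "i = j" if "e [^] i \<otimes> inv (e [^] j) \<in> J" "i \<le> t" "j \<le> t" for i j :: nat
      using no that inv_mem[OF that(1)] by (meson linorder_neqE_nat)
    let ?R = "(\<lambda>i::nat. e [^] i) ` {..t}"
    have "inj_on (\<lambda>i::nat. e [^] i) {..t}"
    proof (rule inj_onI)
      fix i j :: nat assume "i \<in> {..t}" "j \<in> {..t}" and ij: "e [^] i = e [^] j"
      moreover have "e [^] i \<otimes> inv (e [^] j) \<in> J"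
        unfolding ij using e subgroup.one_closed[OF J] by simp
      ultimately show "i = j" using eq by simp
    qed
    then have "card ?R = Suc t" by (simp add: card_image)
    moreover have "separated J ?R"
      unfolding separated_def using e eq by auto
    ultimately show False using bound[of ?R] by simp
  qed
  then obtain i j :: nat where ij: "i < j" "j \<le> t" "e [^] j \<otimes> inv (e [^] i) \<in> J" by blast
  have "e [^] j = e [^] (j - i) \<otimes> e [^] i" using ij e by (simp add: nat_pow_mult)
  with ij e have mem: "e [^] (j - i) \<in> J" by (simp add: m_assoc)
  have "j - i dvd fact t" using ij by (intro dvd_fact) auto
  then obtain q where "fact t = (j - i) * q" by (rule dvdE)
  then have "e [^] (fact t :: nat) = (e [^] (j - i)) [^] q" using e by (simp add: nat_pow_pow)
  moreover have "(e [^] (j - i)) [^] q \<in> J"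
    using subgroup_int_pow_closed[OF J mem, of "int q"] by (simp add: int_pow_int)
  ultimately show ?thesis by simp
qed

text \<open>
  The least exponent \<open>N\<close> of the quotient works: if it had a prime factor \<open>p < c\<close>, then, every element
  being a \<open>p\<close>-th power modulo \<open>J\<close>, already \<open>N / p\<close> would be an exponent.
\<close>

lemma coprime_exponent:
  assumes J: "subgroup J G"
    and bound: "\<And>R. separated J R \<Longrightarrow> finite R \<Longrightarrow> card R \<le> t"
    and div: "\<And>p x. Factorial_Ring.prime p \<Longrightarrow> p < c \<Longrightarrow> x \<in> carrier G \<Longrightarrow> \<exists>y\<in>carrier G. \<exists>l\<in>J. x = y [^] (p::nat) \<otimes> l"
  shows "\<exists>N::nat. (\<forall>x\<in>carrier G. x [^] N \<in> J) \<and> (\<forall>i. 0 < i \<longrightarrow> i < c \<longrightarrow> coprime i N)"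
proof -
  define Q where "Q N \<longleftrightarrow> N > 0 \<and> (\<forall>x\<in>carrier G. x [^] N \<in> J)" for N :: nat
  define N where "N = (LEAST N. Q N)"
  have "Q (fact t)" using finite_index_exponent[OF J bound] by (simp add: Q_def)
  then have N: "Q N" unfolding N_def by (rule LeastI)
  have powJ: "l [^] m \<in> J" if "l \<in> J" for l and m :: nat
    using subgroup_int_pow_closed[OF J that, of "int m"] by (simp add: int_pow_int)
  have no_prime: "\<not> p dvd N" if p: "Factorial_Ring.prime p" "p < c" for p
  proof
    assume "p dvd N"
    then obtain m where m: "N = p * m" by (rule dvdE)
    have m0: "m > 0" "m < N" using N m prime_gt_1_nat[OF p(1)] by (auto simp: Q_def)
    have "x [^] m \<in> J" if x: "x \<in> carrier G" for x
    proof -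
      obtain y l where yl: "y \<in> carrier G" "l \<in> J" "x = y [^] p \<otimes> l" using div[OF p x] by blast
      have lG: "l \<in> carrier G" using yl(2) subgroup.subset[OF J] by blast
      have "x [^] m = y [^] N \<otimes> l [^] m"
        using yl lG by (simp add: nat_pow_distrib nat_pow_pow m)
      then show ?thesis using N yl powJ subgroup.m_closed[OF J] by (simp add: Q_def)
    qed
    with m0 have "Q m" by (simp add: Q_def)
    then have "N \<le> m" unfolding N_def by (rule Least_le)
    with m0 show False by simp
  qed
  have "coprime i N" if i: "0 < i" "i < c" for i
  proof (rule ccontr)
    assume "\<not> coprime i N"
    then obtain p where p: "Factorial_Ring.prime p" "p dvd i" "p dvd N"
      using prime_factor_nat[of "gcd i N"] by (auto simp: coprime_iff_gcd_eq_1)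
    with i no_prime show False by (meson dvd_imp_le order.strict_trans1)
  qed
  then show ?thesis using N by (auto simp: Q_def)
qed

end

lemma group_rank_quotient_le:
  fixes G :: "('a, 'b) monoid_scheme" (structure) and A S :: "'a set"
  assumes G: "comm_group G" and A: "A \<subseteq> carrier G" and S: "S \<subseteq> carrier G" "finite S"
    and gen: "generate G (A \<union> S) = carrier G"
  shows "group_rank (G Mod generate G A) \<le> card S"
proof -
  interpret comm_group G by fact
  let ?N = "generate G A"
  have sub: "subgroup ?N G" by (rule generate_is_subgroup[OF A])
  then have "?N \<lhd> G" by (simp add: normal_iff_subgroup)
  then interpret normal ?N G .
  let ?h = "(#>) ?N"
  have hom: "group_hom G (G Mod ?N) ?h"
    using r_coset_hom_Mod factorgroup_is_group is_group by (simp add: group_hom_def group_hom_axioms_def)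
  have AS: "A \<union> S \<subseteq> carrier G" using A S by blast
  have "generate (G Mod ?N) (?h ` (A \<union> S)) = ?h ` carrier G"
    using group_hom.generate_img[OF hom AS] gen by simp
  also have "\<dots> = carrier (G Mod ?N)" by (auto simp: FactGroup_def RCOSETS_def)
  finally have *: "generate (G Mod ?N) (?h ` (A \<union> S)) = carrier (G Mod ?N)" .
  interpret Q: group "G Mod ?N" by (rule factorgroup_is_group)
  have hS: "?h ` S \<subseteq> carrier (G Mod ?N)" using S by (auto simp: FactGroup_def RCOSETS_def)
  have "?h x \<in> generate (G Mod ?N) (?h ` S)" if "x \<in> A" for x
  proof -
    have "?h x = ?N" using that sub A by (intro coset_join2) (auto intro: generate.incl)
    then show ?thesis using generate.one[of "G Mod ?N"] by (simp add: FactGroup_def)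
  qed
  then have "?h ` (A \<union> S) \<subseteq> generate (G Mod ?N) (?h ` S)"
    by (auto intro: generate.incl)
  then have "carrier (G Mod ?N) \<subseteq> generate (G Mod ?N) (?h ` S)"
    using * Q.generate_subgroup_incl[OF _ Q.generate_is_subgroup[OF hS]] by blast
  then have "generate (G Mod ?N) (?h ` S) = carrier (G Mod ?N)"
    using Q.generate_incl[OF hS] by blast
  then have "group_rank (G Mod ?N) \<le> card (?h ` S)"
    unfolding group_rank_def using hS S by (intro Least_le exI[of _ "?h ` S"]) auto
  also have "\<dots> \<le> card S" by (rule card_image_le[OF S(2)])
  finally show ?thesis .
qed

section \<open>Sublattices of the integer lattice\<close>

abbreviation Zvec :: "nat \<Rightarrow> int Matrix.vec monoid" where
  "Zvec m \<equiv> monoid_vec TYPE(int) m"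

interpretation Zvec: comm_group "Zvec m" for m
  by (rule comm_group_vec)

lemma Zvec_inv: "x \<in> carrier_vec m \<Longrightarrow> inv\<^bsub>Zvec m\<^esub> x = - x"
  by (rule Zvec.inv_equality) (auto simp: monoid_vec_simps)

lemma Zvec_diff:
  "x \<in> carrier_vec m \<Longrightarrow> y \<in> carrier_vec m \<Longrightarrow> x \<otimes>\<^bsub>Zvec m\<^esub> inv\<^bsub>Zvec m\<^esub> y = x - y"
  by (simp add: Zvec_inv monoid_vec_simps minus_add_uminus_vec)

lemma Zvec_pow: "x \<in> carrier_vec m \<Longrightarrow> x [^]\<^bsub>Zvec m\<^esub> (k::nat) = int k \<cdot>\<^sub>v x"
proof (induction k)
  case 0
  then show ?case by (intro eq_vecI) (auto simp: monoid_vec_simps)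
next
  case (Suc k)
  then show ?case by (intro eq_vecI) (auto simp: monoid_vec_simps algebra_simps)
qed

lemma Zvec_separated_iff:
  "Zvec.separated m J R \<longleftrightarrow> R \<subseteq> carrier_vec m \<and> (\<forall>x\<in>R. \<forall>y\<in>R. x - y \<in> J \<longrightarrow> x = y)"
  unfolding Zvec.separated_def monoid_vec_simps(2)
  by (intro conj_cong refl ball_cong) (simp add: Zvec_diff subset_iff)

lemma Zvec_subgroupD:
  assumes "subgroup J (Zvec m)"
  shows "J \<subseteq> carrier_vec m" "0\<^sub>v m \<in> J"
    "\<And>x y. x \<in> J \<Longrightarrow> y \<in> J \<Longrightarrow> x + y \<in> J" "\<And>x. x \<in> J \<Longrightarrow> - x \<in> J"
    "\<And>x y. x \<in> J \<Longrightarrow> y \<in> J \<Longrightarrow> x - y \<in> J"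
proof -
  show 1: "J \<subseteq> carrier_vec m" "0\<^sub>v m \<in> J" and 2: "\<And>x y. x \<in> J \<Longrightarrow> y \<in> J \<Longrightarrow> x + y \<in> J"
    using subgroup.subset[OF assms] subgroup.one_closed[OF assms] subgroup.m_closed[OF assms]
    by (auto simp: monoid_vec_simps)
  show 3: "\<And>x. x \<in> J \<Longrightarrow> - x \<in> J"
    using subgroup.m_inv_closed[OF assms] 1(1) Zvec_inv by (metis subsetD)
  show "x - y \<in> J" if "x \<in> J" "y \<in> J" for x y
    using 2[OF that(1) 3[OF that(2)]] 1(1) that minus_add_uminus_vec[of x m y] by (metis subsetD)
qed

lemma Zvec_smult_mem:
  assumes "subgroup J (Zvec m)" "x \<in> J"
  shows "k \<cdot>\<^sub>v x \<in> J"
proof -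
  have x: "x \<in> carrier_vec m" using assms Zvec_subgroupD(1) by blast
  have nat: "int i \<cdot>\<^sub>v x \<in> J" for i
    using Zvec.subgroup_int_pow_closed[OF assms, of "int i"] Zvec_pow[OF x] by (simp add: int_pow_int)
  show ?thesis
  proof (cases "k \<ge> 0")
    case True
    then show ?thesis using nat[of "nat k"] by simp
  next
    case False
    have "- (int (nat (- k)) \<cdot>\<^sub>v x) \<in> J" using Zvec_subgroupD(4)[OF assms(1) nat] .
    moreover have "- (int (nat (- k)) \<cdot>\<^sub>v x) = k \<cdot>\<^sub>v x" using False by (intro eq_vecI) auto
    ultimately show ?thesis by simp
  qed
qed

text \<open>
  The family \<open>f\<close> may have repeated members, as the rows of a matrix do.
\<close>

definition lincomb :: "nat \<Rightarrow> 'i set \<Rightarrow> ('i \<Rightarrow> int Matrix.vec) \<Rightarrow> ('i \<Rightarrow> int) \<Rightarrow> int Matrix.vec" where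
  "lincomb m I f c = Matrix.vec m (\<lambda>j. \<Sum>i\<in>I. c i * f i $ j)"

lemma lincomb_carrier [simp]: "lincomb m I f c \<in> carrier_vec m"
  by (simp add: lincomb_def)

lemma lincomb_index [simp]: "j < m \<Longrightarrow> lincomb m I f c $ j = (\<Sum>i\<in>I. c i * f i $ j)"
  by (simp add: lincomb_def)

lemma dim_lincomb [simp]: "dim_vec (lincomb m I f c) = m"
  by (simp add: lincomb_def)

lemma lincomb_mem:
  assumes J: "subgroup J (Zvec m)" and "finite I" "\<And>i. i \<in> I \<Longrightarrow> f i \<in> J"
  shows "lincomb m I f c \<in> J"
  using assms(2,3)
proof (induction I rule: finite_induct)
  case empty
  have "lincomb m {} f c = 0\<^sub>v m" by (intro eq_vecI) auto
  then show ?case using Zvec_subgroupD(2)[OF J] by simp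
next
  case (insert i I)
  have fi: "f i \<in> carrier_vec m" using insert.prems Zvec_subgroupD(1)[OF J] by blast
  have "lincomb m (insert i I) f c = c i \<cdot>\<^sub>v f i + lincomb m I f c"
    using insert.hyps fi by (intro eq_vecI) auto
  then show ?case
    using insert Zvec_subgroupD(3)[OF J Zvec_smult_mem[OF J, of "f i" "c i"]] by simp
qed

lemma lincomb_diff:
  "lincomb m I f c - lincomb m I f d = lincomb m I f (\<lambda>i. c i - d i)"
  by (intro eq_vecI) (auto simp: sum_subtractf algebra_simps)

lemma generate_unit_vecs:
  "generate (Zvec m) (unit_vec m ` {..<m}) = carrier_vec m"
proof
  have E: "unit_vec m ` {..<m} \<subseteq> carrier (Zvec m)" by (auto simp: monoid_vec_simps)
  show "generate (Zvec m) (unit_vec m ` {..<m}) \<subseteq> carrier_vec m"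
    using Zvec.generate_incl[OF E] by (simp add: monoid_vec_simps)
  show "carrier_vec m \<subseteq> generate (Zvec m) (unit_vec m ` {..<m})"
  proof
    fix v :: "int Matrix.vec" assume v: "v \<in> carrier_vec m"
    have "lincomb m {..<m} (unit_vec m) (\<lambda>i. v $ i) \<in> generate (Zvec m) (unit_vec m ` {..<m})"
      using Zvec.generate_is_subgroup[OF E] by (intro lincomb_mem) (auto intro: generate.incl)
    moreover have "lincomb m {..<m} (unit_vec m) (\<lambda>i. v $ i) = v"
    proof (rule eq_vecI)
      fix j assume "j < dim_vec v"
      then have j: "j < m" using v by auto
      have "(\<Sum>i<m. v $ i * unit_vec m i $ j) = (\<Sum>i<m. if i = j then v $ i else 0)"
        using j by (intro sum.cong) (auto simp: unit_vec_def)
      then show "lincomb m {..<m} (unit_vec m) (\<lambda>i. v $ i) $ j = v $ j" using j by simp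
    qed (use v in auto)
    ultimately show "v \<in> generate (Zvec m) (unit_vec m ` {..<m})" by simp
  qed
qed

definition left_kernel :: "nat \<Rightarrow> nat \<Rightarrow> (nat \<Rightarrow> int Matrix.vec) \<Rightarrow> (nat \<Rightarrow> int) set" where
  "left_kernel p m f =
     {y \<in> {..<m} \<rightarrow>\<^sub>E {0..<int p}. \<forall>j<m. (\<Sum>i<m. y i * f i $ j) mod int p = 0}"

lemma sum_mod_cong:
  fixes f g :: "'i \<Rightarrow> int"
  assumes "\<And>i. i \<in> I \<Longrightarrow> f i mod a = g i mod a"
  shows "sum f I mod a = sum g I mod a"
proof -
  have "(\<Sum>i\<in>I. f i mod a) = (\<Sum>i\<in>I. g i mod a)" using assms by (rule sum.cong[OF refl])
  then show ?thesis by (metis mod_sum_eq)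
qed

text \<open>
  Modulo \<open>p\<close> the rows \<open>f\<close> span the image of the map \<open>y \<mapsto> \<Sum>\<^sub>i y\<^sub>i f\<^sub>i\<close>, whose index equals the size of its
  kernel. The proof counts the pairs \<open>(r, x)\<close> of a representative \<open>r\<close> and a coefficient vector \<open>x\<close>
  according to \<open>r + \<Sum>\<^sub>i x\<^sub>i f\<^sub>i\<close> modulo \<open>p\<close>: the sum determines \<open>r\<close>, and \<open>x\<close> up to the kernel.
\<close>

lemma card_separated_le_left_kernel:
  assumes J: "subgroup J (Zvec m)" and p: "p > 0"
    and rows: "\<And>i. i < m \<Longrightarrow> f i \<in> J"
    and pJ: "\<And>x. x \<in> carrier_vec m \<Longrightarrow> int p \<cdot>\<^sub>v x \<in> J"
    and R: "Zvec.separated m J R" "finite R"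
  shows "card R \<le> card (left_kernel p m f)"
proof -
  define U where "U = ({..<m} \<rightarrow>\<^sub>E {0..<int p})"
  have finU: "finite U" and U0: "card U > 0"
    using p by (auto simp: U_def card_PiE intro!: finite_PiE)
  have finK: "finite (left_kernel p m f)"
    by (rule finite_subset[OF _ finU]) (auto simp: left_kernel_def U_def)
  define w where "w = lincomb m {..<m} f"
  define red where "red = (\<lambda>(r, x). \<lambda>j\<in>{..<m}. (r $ j + w x $ j) mod int p)"
  define Fb where "Fb y = {z \<in> R \<times> U. red z = y}" for y
  have Rc: "R \<subseteq> carrier_vec m" using R(1) by (simp add: Zvec_separated_iff)
  have fib: "card (Fb y) \<le> card (left_kernel p m f)" for y
  proof (cases "Fb y = {}")
    case True
    then show ?thesis by simp
  next
    case False
    then obtain r0 x0 where z0: "(r0, x0) \<in> Fb y" by auto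
    let ?h = "\<lambda>(r, x). \<lambda>i\<in>{..<m}. (x i - x0 i) mod int p"
    have dvd: "int p dvd (r $ j - r0 $ j) + (w x $ j - w x0 $ j)" if "(r, x) \<in> Fb y" "j < m" for r x j
    proof -
      have "red (r, x) j = red (r0, x0) j" using that z0 by (simp add: Fb_def)
      then have "int p dvd (r $ j + w x $ j) - (r0 $ j + w x0 $ j)"
        using that(2) by (simp add: red_def mod_eq_dvd_iff)
      then show ?thesis by (simp add: algebra_simps)
    qed
    have r_eq: "r = r0" if z: "(r, x) \<in> Fb y" for r x
    proof -
      have c: "r \<in> carrier_vec m" "r0 \<in> carrier_vec m" using z z0 Rc by (auto simp: Fb_def)
      define q where "q = Matrix.vec m (\<lambda>j. ((r $ j - r0 $ j) + (w x $ j - w x0 $ j)) div int p)"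
      have "r - r0 = int p \<cdot>\<^sub>v q - (w x - w x0)"
        using c dvd[OF z] by (intro eq_vecI) (auto simp: q_def w_def)
      moreover have "int p \<cdot>\<^sub>v q \<in> J" by (rule pJ) (simp add: q_def)
      moreover have "w x - w x0 \<in> J"
        unfolding w_def lincomb_diff by (intro lincomb_mem J rows) auto
      ultimately have "r - r0 \<in> J" using Zvec_subgroupD(5)[OF J] by metis
      moreover have "r \<in> R" "r0 \<in> R" using z z0 by (auto simp: Fb_def)
      ultimately show ?thesis using R(1) unfolding Zvec_separated_iff by blast
    qed
    have "inj_on ?h (Fb y)"
    proof (rule inj_onI)
      fix a b assume ab: "a \<in> Fb y" "b \<in> Fb y" "?h a = ?h b"
      obtain r x s x' where rs: "a = (r, x)" "b = (s, x')" by (metis surj_pair)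
      have "r = s" using r_eq ab rs by metis
      moreover have "x = x'"
      proof (rule PiE_ext)
        show xU: "x \<in> {..<m} \<rightarrow>\<^sub>E {0..<int p}" "x' \<in> {..<m} \<rightarrow>\<^sub>E {0..<int p}"
          using ab rs by (auto simp: Fb_def U_def)
        fix i assume i: "i \<in> {..<m}"
        have "(x i - x0 i) mod int p = (x' i - x0 i) mod int p"
          using fun_cong[OF ab(3), of i] i by (simp add: rs)
        then have "int p dvd x i - x' i" by (simp add: mod_eq_dvd_iff)
        then have "x i mod int p = x' i mod int p" by (simp add: mod_eq_dvd_iff)
        then show "x i = x' i" using PiE_mem[OF xU(1) i] PiE_mem[OF xU(2) i] by simp
      qed
      ultimately show "a = b" by (simp add: rs)
    qed
    moreover have "?h ` Fb y \<subseteq> left_kernel p m f"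
    proof
      fix u assume "u \<in> ?h ` Fb y"
      then obtain r x where z: "(r, x) \<in> Fb y" and u: "u = (\<lambda>i\<in>{..<m}. (x i - x0 i) mod int p)"
        by auto
      have "(\<Sum>i<m. u i * f i $ j) mod int p = 0" if j: "j < m" for j
      proof -
        have "int p dvd (\<Sum>i<m. (x i - x0 i) * f i $ j)"
          using dvd[OF z j] r_eq[OF z] j by (simp add: w_def sum_subtractf algebra_simps)
        moreover have "(\<Sum>i<m. u i * f i $ j) mod int p = (\<Sum>i<m. (x i - x0 i) * f i $ j) mod int p"
          by (rule sum_mod_cong) (simp add: u mod_mult_left_eq)
        ultimately show ?thesis by simp
      qed
      then show "u \<in> left_kernel p m f" using p by (auto simp: left_kernel_def u)
    qed
    ultimately show ?thesis using finK by (intro card_inj_on_le)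
  qed
  have "R \<times> U \<subseteq> (\<Union>y\<in>U. Fb y)"
  proof
    fix z assume z: "z \<in> R \<times> U"
    have "red z \<in> U" using p by (auto simp: red_def U_def split: prod.split)
    with z show "z \<in> (\<Union>y\<in>U. Fb y)" by (auto simp: Fb_def)
  qed
  moreover have "finite (\<Union>y\<in>U. Fb y)"
    using finU R(2) by (auto simp: Fb_def)
  ultimately have "card (R \<times> U) \<le> card (\<Union>y\<in>U. Fb y)" by (rule card_mono[rotated])
  also have "\<dots> \<le> (\<Sum>y\<in>U. card (Fb y))" by (rule card_UN_le[OF finU])
  also have "\<dots> \<le> (\<Sum>y\<in>U. card (left_kernel p m f))" by (intro sum_mono fib)
  finally have "card R * card U \<le> card (left_kernel p m f) * card U"
    by (simp add: card_cartesian_product mult.commute)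
  then show ?thesis using U0 by simp
qed

text \<open>
  Reduced modulo 2, taking linear combinations is a surjection from \<open>{0, 1}\<close>-valued coefficients on
  \<open>B\<close> onto a set with \<open>2\<^sup>m\<close> elements. As \<open>B\<close> has at most \<open>m\<close> elements, it is a bijection.
\<close>

lemma mod2_spanning_independent:
  fixes B :: "int Matrix.vec set"
  assumes B: "finite B" "card B \<le> m" "B \<subseteq> carrier_vec m"
    and gen: "generate (Zvec m) ((\<cdot>\<^sub>v) 2 ` carrier_vec m \<union> B) = carrier_vec m"
  shows "card B = m"
    and "(\<And>j. j < m \<Longrightarrow> even (\<Sum>b\<in>B. c b * b $ j)) \<Longrightarrow> b \<in> B \<Longrightarrow> even (c b)"
proof -
  define H where "H = {v \<in> carrier_vec m. \<exists>c. \<forall>j<m. even (v $ j - (\<Sum>b\<in>B. c b * b $ j))}"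
  have H: "subgroup H (Zvec m)"
  proof (rule subgroup.intro)
    show "H \<subseteq> carrier (Zvec m)" by (auto simp: H_def monoid_vec_simps)
    show "\<one>\<^bsub>Zvec m\<^esub> \<in> H" by (auto simp: H_def monoid_vec_simps intro!: exI[of _ "\<lambda>_. 0"])
    fix x assume x: "x \<in> H"
    then obtain c where c: "\<And>j. j < m \<Longrightarrow> even (x $ j - (\<Sum>b\<in>B. c b * b $ j))" and xc: "x \<in> carrier_vec m"
      by (auto simp: H_def)
    have "even ((- x) $ j - (\<Sum>b\<in>B. - c b * b $ j))" if "j < m" for j
      using c[OF that] that xc by (simp add: sum_negf)
    then have "- x \<in> H" using xc by (auto simp: H_def intro!: exI[of _ "\<lambda>b. - c b"])
    then show "inv\<^bsub>Zvec m\<^esub> x \<in> H" using xc by (simp add: Zvec_inv)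
    fix y assume "y \<in> H"
    then obtain d where d: "\<And>j. j < m \<Longrightarrow> even (y $ j - (\<Sum>b\<in>B. d b * b $ j))" and yc: "y \<in> carrier_vec m"
      by (auto simp: H_def)
    have "even ((x + y) $ j - (\<Sum>b\<in>B. (c b + d b) * b $ j))" if "j < m" for j
    proof -
      have "(x + y) $ j - (\<Sum>b\<in>B. (c b + d b) * b $ j)
          = (x $ j - (\<Sum>b\<in>B. c b * b $ j)) + (y $ j - (\<Sum>b\<in>B. d b * b $ j))"
        using that yc by (simp add: sum.distrib algebra_simps)
      then show ?thesis using c[OF that] d[OF that] by simp
    qed
    then have "\<exists>e. \<forall>j<m. even ((x + y) $ j - (\<Sum>b\<in>B. e b * b $ j))"
      by (intro exI[of _ "\<lambda>b. c b + d b"] allI impI)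
    then have "x + y \<in> H" using xc yc by (simp add: H_def)
    then show "x \<otimes>\<^bsub>Zvec m\<^esub> y \<in> H" by (simp add: monoid_vec_simps)
  qed
  have "(\<cdot>\<^sub>v) 2 ` carrier_vec m \<union> B \<subseteq> H"
  proof
    fix v assume v: "v \<in> (\<cdot>\<^sub>v) 2 ` carrier_vec m \<union> B"
    show "v \<in> H"
    proof (cases "v \<in> B")
      case True
      have "(\<Sum>b\<in>B. (if b = v then 1 else 0) * b $ j) = v $ j" for j
      proof -
        have "(\<Sum>b\<in>B. (if b = v then 1 else 0) * b $ j) = (\<Sum>b\<in>B. if b = v then b $ j else 0)"
          by (intro sum.cong) auto
        then show ?thesis using True B(1) by simp
      qed
      then show ?thesis using True B(3) unfolding H_def
        by (intro CollectI conjI exI[of _ "\<lambda>b. if b = v then 1 else 0"]) auto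
    next
      case False
      with v show ?thesis by (auto simp: H_def intro!: exI[of _ "\<lambda>_. 0"])
    qed
  qed
  from Zvec.generate_subgroup_incl[OF this H] gen have all: "carrier_vec m \<subseteq> H" by simp
  define U where "U = (B \<rightarrow>\<^sub>E {0, 1::int})"
  define V where "V = ({..<m} \<rightarrow>\<^sub>E {0, 1::int})"
  define \<phi> where "\<phi> c = (\<lambda>j\<in>{..<m}. (\<Sum>b\<in>B. c b * b $ j) mod 2)" for c
  have red: "\<phi> (\<lambda>b\<in>B. c b mod 2) = \<phi> c" for c
    unfolding \<phi>_def by (intro ext) (auto intro!: sum_mod_cong simp: mod_mult_left_eq)
  have redU: "(\<lambda>b\<in>B. c b mod 2) \<in> U" for c by (auto simp: U_def)
  have "V \<subseteq> \<phi> ` U"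
  proof
    fix y assume y: "y \<in> V"
    have "Matrix.vec m y \<in> H" using all by auto
    then obtain c where c: "\<And>j. j < m \<Longrightarrow> even (y j - (\<Sum>b\<in>B. c b * b $ j))" by (auto simp: H_def)
    have "\<phi> c = y"
    proof (rule ext)
      fix j
      show "\<phi> c j = y j"
      proof (cases "j < m")
        case True
        have "y j \<in> {0, 1}" using y True by (auto simp: V_def)
        then have "y j mod 2 = y j" by auto
        moreover have "y j mod 2 = (\<Sum>b\<in>B. c b * b $ j) mod 2"
          using c[OF True] by (simp add: mod_eq_dvd_iff)
        ultimately show ?thesis using True by (simp add: \<phi>_def)
      next
        case False
        then show ?thesis using y by (auto simp: \<phi>_def V_def PiE_def extensional_def)
      qed
    qed
    then show "y \<in> \<phi> ` U" using red[of c] redU[of c] by (metis image_eqI)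
  qed
  moreover have finU: "finite U" using B by (auto simp: U_def intro: finite_PiE)
  ultimately have "card V \<le> card U" by (meson surj_card_le)
  moreover have c2: "card {0, 1::int} = 2" by simp
  then have cU: "card U = 2 ^ card B" "card V = 2 ^ m"
    using B c2 by (simp_all only: U_def V_def card_PiE finite_lessThan prod_constant card_lessThan)
  ultimately have "m \<le> card B" by simp
  with B show m: "card B = m" by simp
  have "\<phi> ` U \<subseteq> V" by (auto simp: \<phi>_def V_def)
  with \<open>V \<subseteq> \<phi> ` U\<close> have "card (\<phi> ` U) = card U" using cU m by (simp add: subset_antisym)
  then have inj: "inj_on \<phi> U" by (rule eq_card_imp_inj_on[OF finU])
  assume ev: "\<And>j. j < m \<Longrightarrow> even (\<Sum>b\<in>B. c b * b $ j)" and b: "b \<in> B"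
  have "\<phi> (\<lambda>b\<in>B. c b mod 2) = \<phi> (\<lambda>b\<in>B. 0 mod 2)"
    unfolding red using ev by (auto simp: \<phi>_def intro!: ext)
  then have "(\<lambda>b\<in>B. c b mod 2) = (\<lambda>b\<in>B. 0 mod 2)" using inj redU by (meson inj_onD)
  from fun_cong[OF this, of b] b show "even (c b)" by (simp add: even_iff_mod_2_eq_zero)
qed

text \<open>
  Independence modulo 2 implies independence over the integers by infinite descent: the
  coefficients of a relation are even, and halving them gives another relation.
\<close>

lemma mod2_spanning_lincomb_inj:
  fixes B :: "int Matrix.vec set"
  assumes B: "finite B" "card B \<le> m" "B \<subseteq> carrier_vec m"
    and gen: "generate (Zvec m) ((\<cdot>\<^sub>v) 2 ` carrier_vec m \<union> B) = carrier_vec m"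
    and zero: "\<And>j. j < m \<Longrightarrow> (\<Sum>b\<in>B. c b * b $ j) = 0" and b: "b \<in> B"
  shows "c b = 0"
proof -
  have dvd: "2 ^ k dvd c b" if "\<And>j. j < m \<Longrightarrow> (\<Sum>b\<in>B. c b * b $ j) = 0" for c k
    using that
  proof (induction k arbitrary: c)
    case 0
    then show ?case by simp
  next
    case (Suc k)
    have ev: "even (c b)" if "b \<in> B" for b
      by (rule mod2_spanning_independent(2)[OF B gen _ that]) (simp add: Suc.prems)
    have "(\<Sum>b\<in>B. (c b div 2) * b $ j) = 0" if "j < m" for j
    proof -
      have "2 * (\<Sum>b\<in>B. (c b div 2) * b $ j) = (\<Sum>b\<in>B. c b * b $ j)"
        unfolding sum_distrib_left
      proof (rule sum.cong)
        fix b assume "b \<in> B"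
        then show "2 * (c b div 2 * b $ j) = c b * b $ j"
          using ev by (metis dvd_mult_div_cancel mult.assoc)
      qed simp
      then show ?thesis using Suc.prems[OF that] by simp
    qed
    from Suc.IH[OF this] have "2 * 2 ^ k dvd 2 * (c b div 2)" by simp
    then show ?case using ev[OF b] by simp
  qed
  have "2 ^ nat \<bar>c b\<bar> dvd c b" by (rule dvd[OF zero])
  then show ?thesis
  proof (rule contrapos_pp)
    assume "c b \<noteq> 0"
    show "\<not> 2 ^ nat \<bar>c b\<bar> dvd c b"
    proof
      assume "2 ^ nat \<bar>c b\<bar> dvd c b"
      then have "\<bar>2 ^ nat \<bar>c b\<bar>\<bar> \<le> \<bar>c b\<bar>" using \<open>c b \<noteq> 0\<close> by (rule dvd_imp_le_int[rotated])
      moreover have "int (nat \<bar>c b\<bar>) < 2 ^ nat \<bar>c b\<bar>"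
        by (rule of_nat_less_two_power)
      ultimately show False by simp
    qed
  qed
qed

text \<open>
  A volume argument. Add to each representative \<open>r \<in> R\<close> all combinations of
  \<open>B\<close> with coefficients in \<open>{0..<N}\<close>. These are \<open>card R * N ^ m\<close> distinct points, and by the bound on
  the columns they lie in a cube of side about \<open>2 K N\<close>; compare for large \<open>N\<close>.
\<close>

lemma card_separated_le_box:
  fixes B :: "int Matrix.vec set"
  assumes B: "finite B" "card B \<le> m" "B \<subseteq> carrier_vec m"
    and gen: "generate (Zvec m) ((\<cdot>\<^sub>v) 2 ` carrier_vec m \<union> B) = carrier_vec m"
    and col: "\<And>j. j < m \<Longrightarrow> (\<Sum>b\<in>B. \<bar>b $ j\<bar>) \<le> int K"
    and J: "subgroup J (Zvec m)" "B \<subseteq> J"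
    and R: "Zvec.separated m J R" "finite R"
  shows "card R \<le> (2 * K + 1) ^ m"
proof -
  have Rc: "R \<subseteq> carrier_vec m" using R(1) by (simp add: Zvec_separated_iff)
  define \<rho> where "\<rho> = nat (\<Sum>r\<in>R. \<Sum>j<m. \<bar>r $ j\<bar>)"
  have rho: "\<bar>r $ j\<bar> \<le> int \<rho>" if "r \<in> R" "j < m" for r :: "int Matrix.vec" and j
  proof -
    have "\<bar>r $ j\<bar> \<le> (\<Sum>j<m. \<bar>r $ j\<bar>)" using that by (intro member_le_sum) auto
    also have "\<dots> \<le> (\<Sum>r\<in>R. \<Sum>j<m. \<bar>r $ j\<bar>)"
      using that R(2) by (intro member_le_sum[of r R "\<lambda>r. \<Sum>j<m. \<bar>r $ j\<bar>"]) (auto intro: sum_nonneg)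
    finally show ?thesis by (simp add: \<rho>_def sum_nonneg)
  qed
  \<comment> \<open>with this choice the side \<open>2 * (K * N + \<rho>) + 1\<close> of the cube is exactly \<open>(2 * K + 1) * N\<close>\<close>
  define N where "N = 2 * \<rho> + 1"
  define W where "W = ({..<m} \<rightarrow>\<^sub>E {- int (K * N + \<rho>)..int (K * N + \<rho>)})"
  let ?h = "\<lambda>(r, c). \<lambda>j\<in>{..<m}. r $ j + (\<Sum>b\<in>B. c b * b $ j)"
  let ?X = "R \<times> (B \<rightarrow>\<^sub>E {0..<int N})"
  have "inj_on ?h ?X"
  proof (rule inj_onI)
    fix a a' assume A: "a \<in> ?X" "a' \<in> ?X" "?h a = ?h a'"
    obtain r c s d where rs: "a = (r, c)" "a' = (s, d)" by (metis surj_pair)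
    have mem: "r \<in> R" "s \<in> R" and cd: "c \<in> B \<rightarrow>\<^sub>E {0..<int N}" "d \<in> B \<rightarrow>\<^sub>E {0..<int N}"
      using A rs by auto
    have eq: "r $ j - s $ j = (\<Sum>b\<in>B. (d b - c b) * b $ j)" if "j < m" for j
      using fun_cong[OF A(3), of j] that by (simp add: rs sum_subtractf algebra_simps)
    have "r - s = lincomb m B (\<lambda>b. b) (\<lambda>b. d b - c b)"
      using eq mem Rc by (intro eq_vecI) auto
    moreover have "lincomb m B (\<lambda>b. b) (\<lambda>b. d b - c b) \<in> J"
      using J B by (intro lincomb_mem) auto
    ultimately have "r = s" using R(1) mem unfolding Zvec_separated_iff by metis
    then have z: "(\<Sum>b\<in>B. (d b - c b) * b $ j) = 0" if "j < m" for j using eq[OF that] by simp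
    have "c = d"
    proof (rule PiE_ext[OF cd])
      fix b assume "b \<in> B"
      from mod2_spanning_lincomb_inj[OF B gen z this] show "c b = d b" by simp
    qed
    with \<open>r = s\<close> show "a = a'" by (simp add: rs)
  qed
  moreover have "?h ` ?X \<subseteq> W"
  proof
    fix u assume "u \<in> ?h ` ?X"
    then obtain r c where r: "r \<in> R" and c: "c \<in> B \<rightarrow>\<^sub>E {0..<int N}"
      and u: "u = (\<lambda>j\<in>{..<m}. r $ j + (\<Sum>b\<in>B. c b * b $ j))" by auto
    have "\<bar>r $ j + (\<Sum>b\<in>B. c b * b $ j)\<bar> \<le> int (K * N + \<rho>)" if j: "j < m" for j
    proof -
      have "\<bar>\<Sum>b\<in>B. c b * b $ j\<bar> \<le> (\<Sum>b\<in>B. \<bar>c b * b $ j\<bar>)" by (rule sum_abs)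
      also have "\<dots> \<le> (\<Sum>b\<in>B. int N * \<bar>b $ j\<bar>)"
      proof (rule sum_mono)
        fix b assume "b \<in> B"
        then have "c b \<in> {0..<int N}" using c by auto
        then show "\<bar>c b * b $ j\<bar> \<le> int N * \<bar>b $ j\<bar>" by (simp add: abs_mult mult_right_mono)
      qed
      also have "\<dots> \<le> int N * int K" using col[OF j] by (simp add: sum_distrib_left[symmetric] mult_left_mono)
      finally have "\<bar>\<Sum>b\<in>B. c b * b $ j\<bar> \<le> int (K * N)" by (simp add: mult.commute)
      with rho[OF r j] show ?thesis by linarith
    qed
    then show "u \<in> W"
      unfolding W_def u by (simp only: restrict_PiE_iff) (simp add: abs_le_iff, force)
  qed
  moreover have "finite W" by (auto simp: W_def intro: finite_PiE)
  ultimately have "card ?X \<le> card W" by (intro card_inj_on_le)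
  moreover have "card ?X = card R * N ^ m"
    using B mod2_spanning_independent(1)[OF B gen] by (simp add: card_cartesian_product card_PiE)
  moreover have "card W = ((2 * K + 1) * N) ^ m"
  proof -
    have "nat (int (K * N + \<rho>) + int (K * N + \<rho>) + 1) = (2 * K + 1) * N"
      by (simp add: N_def algebra_simps nat_add_distrib nat_mult_distrib)
    then show ?thesis by (simp add: W_def card_PiE)
  qed
  ultimately have "card R * N ^ m \<le> (2 * K + 1) ^ m * N ^ m"
    by (simp only: power_mult_distrib)
  moreover have "0 < N ^ m" by (simp add: N_def)
  ultimately show ?thesis by (rule mult_right_le_imp_le)
qed

lemma subgroup_multiples_plus:
  assumes J: "subgroup J (Zvec m)"
  shows "subgroup {p \<cdot>\<^sub>v y + l | y l. y \<in> carrier_vec m \<and> l \<in> J} (Zvec m)" (is "subgroup ?H _")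
proof (rule subgroup.intro)
  note JD = Zvec_subgroupD[OF J]
  show "?H \<subseteq> carrier (Zvec m)" using JD(1) by (auto simp: monoid_vec_simps)
  have "0\<^sub>v m = p \<cdot>\<^sub>v 0\<^sub>v m + 0\<^sub>v m" by (intro eq_vecI) auto
  then show "\<one>\<^bsub>Zvec m\<^esub> \<in> ?H" using JD(2) zero_carrier_vec[of m] unfolding monoid_vec_simps by blast
  fix x assume "x \<in> ?H"
  then obtain y l where x: "x = p \<cdot>\<^sub>v y + l" "y \<in> carrier_vec m" "l \<in> J" by blast
  then have lc: "l \<in> carrier_vec m" using JD(1) by blast
  have "- x = p \<cdot>\<^sub>v (- y) + (- l)" using x lc by (intro eq_vecI) auto
  moreover have "- y \<in> carrier_vec m" using x by simp
  ultimately have "- x \<in> ?H" using JD(4)[OF x(3)] by blast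
  then show "inv\<^bsub>Zvec m\<^esub> x \<in> ?H" using x lc by (simp add: Zvec_inv)
  fix x' assume "x' \<in> ?H"
  then obtain y' l' where x': "x' = p \<cdot>\<^sub>v y' + l'" "y' \<in> carrier_vec m" "l' \<in> J" by blast
  then have lc': "l' \<in> carrier_vec m" using JD(1) by blast
  have "x + x' = p \<cdot>\<^sub>v (y + y') + (l + l')"
    using x x' lc lc' by (intro eq_vecI) (auto simp: algebra_simps)
  moreover have "y + y' \<in> carrier_vec m" using x x' by simp
  ultimately show "x \<otimes>\<^bsub>Zvec m\<^esub> x' \<in> ?H" using JD(3)[OF x(3) x'(3)] unfolding monoid_vec_simps by blast
qed

lemma sum_abs_unit_vecs:
  assumes "j < m"
  shows "(\<Sum>b\<in>unit_vec m ` {..<m}. \<bar>b $ j :: int\<bar>) \<le> 1"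
proof -
  have "(\<Sum>b\<in>unit_vec m ` {..<m}. \<bar>b $ j :: int\<bar>) \<le> (\<Sum>i<m. \<bar>unit_vec m i $ j\<bar>)"
    by (rule order_trans[OF sum_image_le]) auto
  also have "\<dots> = (\<Sum>i<m. if i = j then 1 else 0)"
    using assms by (intro sum.cong) (auto simp: unit_vec_def)
  also have "\<dots> = 1" using assms by simp
  finally show ?thesis .
qed

text \<open>
  The deterministic bound on the number of generators of \<open>\<int>\<^sup>m\<close> modulo the span of the rows \<open>f\<close>. The
  summand \<open>c s\<close> pays for filling the row lattice modulo every prime below \<open>c\<close>; the condition
  \<open>c \<ge> 3\<close> ensures that 2 is among these primes. The remaining quotient has at most
  \<open>(2 D + 3)\<^sup>m\<close> elements and an exponent without prime factors below \<open>c\<close>, which gives the second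
  summand.
\<close>

lemma lattice_generators:
  fixes f :: "nat \<Rightarrow> int Matrix.vec" and s :: real
  assumes f: "\<And>i. i < m \<Longrightarrow> f i \<in> carrier_vec m"
    and col: "\<And>j. j < m \<Longrightarrow> (\<Sum>i<m. \<bar>f i $ j\<bar>) \<le> int D"
    and s: "s \<ge> 0" and c: "c \<ge> 3"
    and ker: "\<And>p. Factorial_Ring.prime p \<Longrightarrow> p < c \<Longrightarrow> real (card (left_kernel p m f)) \<le> 2 powr s"
  shows "\<exists>S\<subseteq>carrier_vec m. finite S \<and> generate (Zvec m) (f ` {..<m} \<union> S) = carrier_vec m \<and>
           real (card S) \<le> real c * s + real m * log c (2 * D + 3)"
proof -
  define L where "L = f ` {..<m}"
  define E where "E = (unit_vec m :: nat \<Rightarrow> int Matrix.vec) ` {..<m}"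
  have Lc: "L \<subseteq> carrier_vec m" and finL: "finite L" using f by (auto simp: L_def)
  have Ec: "E \<subseteq> carrier_vec m" and finE: "finite E" by (auto simp: E_def)
  have genE: "generate (Zvec m) (K \<union> E') = carrier_vec m"
    if "E \<subseteq> generate (Zvec m) (K \<union> E')" "K \<subseteq> carrier_vec m" "E' \<subseteq> carrier_vec m" for K E'
  proof
    have KE: "K \<union> E' \<subseteq> carrier (Zvec m)" using that by (simp add: monoid_vec_simps)
    show "generate (Zvec m) (K \<union> E') \<subseteq> carrier_vec m"
      using Zvec.generate_incl[OF KE] by (simp add: monoid_vec_simps)
    show "carrier_vec m \<subseteq> generate (Zvec m) (K \<union> E')"
      using Zvec.generate_subgroup_incl[OF that(1) Zvec.generate_is_subgroup[OF KE]]
        generate_unit_vecs[of m] by (simp add: E_def)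
  qed
  have genKE: "generate (Zvec m) (K \<union> E) = carrier_vec m" if "K \<subseteq> carrier_vec m" for K
    using that Ec by (intro genE) (auto intro: generate.incl)
  define Mul where "Mul p = (\<cdot>\<^sub>v) (int p) ` (carrier_vec m :: int Matrix.vec set)" for p :: nat
  have Mul_c: "Mul p \<subseteq> carrier_vec m" for p by (auto simp: Mul_def)
  define P where "P = {p::nat. Factorial_Ring.prime p \<and> p < c}"
  have finP: "finite P" by (rule finite_subset[of _ "{..<c}"]) (auto simp: P_def)
  have "\<exists>T\<subseteq>E. generate (Zvec m) ((L \<union> Mul p) \<union> T) = carrier_vec m \<and>
      p ^ card T \<le> card (left_kernel p m f)" if p: "p \<in> P" for p :: nat
  proof -
    have pr: "Factorial_Ring.prime p" using p by (simp add: P_def)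
    have Kc: "L \<union> Mul p \<subseteq> carrier (Zvec m)" using Lc Mul_c by (simp add: monoid_vec_simps)
    note sub = Zvec.generate_is_subgroup[OF Kc]
    have pm: "int p \<cdot>\<^sub>v x \<in> generate (Zvec m) (L \<union> Mul p)" if "x \<in> carrier_vec m" for x
      using that by (intro generate.incl) (auto simp: Mul_def)
    have "\<exists>T\<subseteq>E. generate (Zvec m) ((L \<union> Mul p) \<union> T) = carrier (Zvec m) \<and>
      p ^ card T \<le> card (left_kernel p m f)"
    proof (rule Zvec.short_generating_set[OF Kc _ finE, where N = p])
      show "E \<subseteq> carrier (Zvec m)" using Ec by (simp add: monoid_vec_simps)
      show "generate (Zvec m) (L \<union> Mul p \<union> E) = carrier (Zvec m)"
        using genKE[of "L \<union> Mul p"] Kc by (simp add: monoid_vec_simps)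
      show "x [^]\<^bsub>Zvec m\<^esub> p \<in> generate (Zvec m) (L \<union> Mul p)" if "x \<in> E" for x
        using that Ec pm by (subst Zvec_pow[of _ m]) auto
      show "coprime i p" if "0 < i" "i < p" for i
        using prime_imp_coprime[OF pr, of i] nat_dvd_not_less[OF that] by (simp add: coprime_commute)
      show "card R \<le> card (left_kernel p m f)"
        if "Zvec.separated m (generate (Zvec m) (L \<union> Mul p)) R" "finite R" for R
        using prime_gt_0_nat[OF pr] pm that
        by (intro card_separated_le_left_kernel[OF sub]) (auto intro: generate.incl simp: L_def)
    qed
    then show ?thesis by (simp add: monoid_vec_simps)
  qed
  then have "\<forall>p\<in>P. \<exists>T. T \<subseteq> E \<and> generate (Zvec m) ((L \<union> Mul p) \<union> T) = carrier_vec m \<and>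
      p ^ card T \<le> card (left_kernel p m f)" by simp
  from bchoice[OF this] obtain T where "\<forall>p\<in>P. T p \<subseteq> E \<and>
      generate (Zvec m) ((L \<union> Mul p) \<union> T p) = carrier_vec m \<and>
      p ^ card (T p) \<le> card (left_kernel p m f)" by (elim exE)
  then have T: "\<And>p. p \<in> P \<Longrightarrow> T p \<subseteq> E"
    and Tgen: "\<And>p. p \<in> P \<Longrightarrow> generate (Zvec m) ((L \<union> Mul p) \<union> T p) = carrier_vec m"
    and Tcard: "\<And>p. p \<in> P \<Longrightarrow> p ^ card (T p) \<le> card (left_kernel p m f)" by simp_all
  have Ts: "real (card (T p)) \<le> s" if p: "p \<in> P" for p :: nat
  proof -
    have "(2::nat) ^ card (T p) \<le> p ^ card (T p)"
      using p prime_ge_2_nat by (intro power_mono) (auto simp: P_def)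
    also note Tcard[OF p]
    finally have "2 ^ card (T p) \<le> real (card (left_kernel p m f))"
      by (metis of_nat_le_iff of_nat_numeral of_nat_power)
    also have "\<dots> \<le> 2 powr s" using p ker by (simp add: P_def)
    finally show ?thesis by (simp add: powr_realpow[symmetric])
  qed
  \<comment> \<open>the vectors that fill the row lattice modulo all primes below \<open>c\<close> simultaneously\<close>
  define S1 where "S1 = (\<Union>p\<in>P. T p)"
  have S1E: "S1 \<subseteq> E" using T by (auto simp: S1_def)
  then have S1c: "S1 \<subseteq> carrier_vec m" and finS1: "finite S1" using Ec finite_subset[OF S1E finE] by auto
  have "card S1 \<le> (\<Sum>p\<in>P. card (T p))" unfolding S1_def by (rule card_UN_le[OF finP])
  then have "real (card S1) \<le> (\<Sum>p\<in>P. real (card (T p)))" by (simp only: of_nat_le_iff of_nat_sum[symmetric])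
  also have "\<dots> \<le> (\<Sum>p\<in>P. s)" by (intro sum_mono Ts)
  also have "\<dots> = real (card P) * s" by simp
  also have "card P \<le> c" using card_mono[of "{..<c}" P] by (auto simp: P_def)
  then have "real (card P) * s \<le> real c * s" using s by (intro mult_right_mono) auto
  finally have cardS1: "real (card S1) \<le> real c * s" .
  define J where "J = generate (Zvec m) (L \<union> S1)"
  have LS1: "L \<union> S1 \<subseteq> carrier (Zvec m)" using Lc S1c by (simp add: monoid_vec_simps)
  have J: "subgroup J (Zvec m)" unfolding J_def by (rule Zvec.generate_is_subgroup[OF LS1])
  have LS1J: "L \<union> S1 \<subseteq> J" by (auto simp: J_def intro: generate.incl)
  have bound: "card R \<le> (2 * D + 3) ^ m" if R: "Zvec.separated m J R" "finite R" for R
  proof -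
    have P2: "2 \<in> P" using c by (simp add: P_def)
    have LT2: "L \<union> T 2 \<subseteq> carrier_vec m" using Lc T[OF P2] Ec by blast
    note sub2 = Zvec.generate_is_subgroup[of "Mul 2"]
    \<comment> \<open>a basis modulo 2 that consists of rows and unit vectors, so that its column sums stay bounded\<close>
    have "\<exists>B\<subseteq>L \<union> T 2. generate (Zvec m) (Mul 2 \<union> B) = carrier (Zvec m) \<and> 2 ^ card B \<le> (2::nat) ^ m"
    proof (rule Zvec.short_generating_set[where N = 2])
      show "Mul 2 \<subseteq> carrier (Zvec m)" "L \<union> T 2 \<subseteq> carrier (Zvec m)"
        using Mul_c LT2 by (simp_all add: monoid_vec_simps)
      show "finite (L \<union> T 2)" using finL finite_subset[OF T[OF P2] finE] by simp
      show "generate (Zvec m) (Mul 2 \<union> (L \<union> T 2)) = carrier (Zvec m)"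
        using Tgen[OF P2] by (simp add: monoid_vec_simps Un_ac)
      have pm: "int 2 \<cdot>\<^sub>v x \<in> generate (Zvec m) (Mul 2)" if "x \<in> carrier_vec m" for x
        using that by (intro generate.incl) (auto simp: Mul_def)
      show "x [^]\<^bsub>Zvec m\<^esub> (2::nat) \<in> generate (Zvec m) (Mul 2)" if "x \<in> L \<union> T 2" for x
        using that LT2 pm by (subst Zvec_pow[of _ m]) auto
      show "coprime i 2" if "0 < i" "i < 2" for i :: nat using that by (simp add: less_2_cases_iff)
      fix R assume R: "Zvec.separated m (generate (Zvec m) (Mul 2)) R" "finite R"
      have sub: "subgroup (generate (Zvec m) (Mul 2)) (Zvec m)"
        using Mul_c by (intro Zvec.generate_is_subgroup) (simp add: monoid_vec_simps)
      \<comment> \<open>for zero rows the kernel is everything, and the bound becomes the index of \<open>2 \<int>\<^sup>m\<close>\<close>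
      have "card R \<le> card (left_kernel 2 m (\<lambda>_. 0\<^sub>v m))"
        using R pm Zvec_subgroupD(2)[OF sub] by (intro card_separated_le_left_kernel[OF sub]) auto
      also have "\<dots> \<le> card ({..<m} \<rightarrow>\<^sub>E {0..<int 2})"
        by (intro card_mono finite_PiE) (auto simp: left_kernel_def)
      also have "\<dots> = 2 ^ m" by (simp add: card_PiE)
      finally show "card R \<le> 2 ^ m" .
    qed
    then obtain B where B: "B \<subseteq> L \<union> T 2" "generate (Zvec m) (Mul 2 \<union> B) = carrier_vec m"
      "card B \<le> m" by (auto simp: monoid_vec_simps)
    have finB: "finite B"
      using finite_subset[OF B(1)] finL finite_subset[OF T[OF P2] finE] by simp
    have "card R \<le> (2 * (D + 1) + 1) ^ m"
    proof (rule card_separated_le_box[OF finB B(3) _ _ _ J _ R])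
      show "B \<subseteq> carrier_vec m" using B(1) LT2 by blast
      show "generate (Zvec m) ((\<cdot>\<^sub>v) 2 ` carrier_vec m \<union> B) = carrier_vec m"
        using B(2) by (simp add: Mul_def)
      show "B \<subseteq> J" using B(1) LS1J P2 by (auto simp: S1_def)
      fix j assume j: "j < m"
      have "(\<Sum>b\<in>B. \<bar>b $ j\<bar>) \<le> (\<Sum>b\<in>L \<union> E. \<bar>b $ j\<bar>)"
        using B(1) T[OF P2] finL finE by (intro sum_mono2) auto
      also have "\<dots> \<le> (\<Sum>b\<in>L. \<bar>b $ j\<bar>) + (\<Sum>b\<in>E. \<bar>b $ j\<bar>)"
        using finL finE by (subst sum_Un) (auto intro: sum_nonneg)
      also have "(\<Sum>b\<in>L. \<bar>b $ j\<bar>) \<le> (\<Sum>i<m. \<bar>f i $ j\<bar>)"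
        unfolding L_def by (rule order_trans[OF sum_image_le]) auto
      also have "(\<Sum>i<m. \<bar>f i $ j\<bar>) \<le> int D" by (rule col[OF j])
      also have "(\<Sum>b\<in>E. \<bar>b $ j\<bar>) \<le> 1" unfolding E_def by (rule sum_abs_unit_vecs[OF j])
      finally show "(\<Sum>b\<in>B. \<bar>b $ j\<bar>) \<le> int (D + 1)" by simp
    qed
    moreover have "2 * (D + 1) + 1 = 2 * D + 3" by simp
    ultimately show ?thesis by (simp only:)
  qed
  have div: "\<exists>y\<in>carrier (Zvec m). \<exists>l\<in>J. x = y [^]\<^bsub>Zvec m\<^esub> p \<otimes>\<^bsub>Zvec m\<^esub> l"
    if p: "Factorial_Ring.prime p" "p < c" and x: "x \<in> carrier (Zvec m)" for p x
  proof -
    have pP: "p \<in> P" using p by (simp add: P_def)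
    let ?H = "{int p \<cdot>\<^sub>v y + l | y l. y \<in> carrier_vec m \<and> l \<in> J}"
    have "u \<in> ?H" if "u \<in> Mul p" for u
    proof -
      from that obtain y where y: "y \<in> carrier_vec m" "u = int p \<cdot>\<^sub>v y" by (auto simp: Mul_def)
      then have "u = int p \<cdot>\<^sub>v y + 0\<^sub>v m" by simp
      with y(1) Zvec_subgroupD(2)[OF J] show ?thesis by blast
    qed
    moreover have "u \<in> ?H" if "u \<in> J" for u
    proof -
      have "u = int p \<cdot>\<^sub>v 0\<^sub>v m + u" using subsetD[OF Zvec_subgroupD(1)[OF J] that] by (intro eq_vecI) auto
      then show ?thesis using that zero_carrier_vec[of m] by blast
    qed
    moreover have "L \<union> T p \<subseteq> J" using LS1J pP by (auto simp: S1_def)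
    ultimately have "(L \<union> Mul p) \<union> T p \<subseteq> ?H" by blast
    from Zvec.generate_subgroup_incl[OF this subgroup_multiples_plus[OF J]] Tgen[OF pP] x
    have "x \<in> ?H" by (auto simp: monoid_vec_simps)
    then obtain y l where "x = int p \<cdot>\<^sub>v y + l" "y \<in> carrier_vec m" "l \<in> J" by blast
    then show ?thesis by (intro bexI[of _ y] bexI[of _ l]) (simp_all add: Zvec_pow monoid_vec_simps)
  qed
  obtain N where N: "\<forall>x\<in>carrier (Zvec m). x [^]\<^bsub>Zvec m\<^esub> (N::nat) \<in> J"
    "\<forall>i. 0 < i \<longrightarrow> i < c \<longrightarrow> coprime i N"
    using Zvec.coprime_exponent[OF J bound div] by blast
  have "\<exists>T'\<subseteq>E. generate (Zvec m) ((L \<union> S1) \<union> T') = carrier (Zvec m) \<and> c ^ card T' \<le> (2 * D + 3) ^ m"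
  proof (rule Zvec.short_generating_set[OF LS1 _ finE, where N = N])
    show "E \<subseteq> carrier (Zvec m)" using Ec by (simp add: monoid_vec_simps)
    show "generate (Zvec m) (L \<union> S1 \<union> E) = carrier (Zvec m)"
      using genKE[of "L \<union> S1"] LS1 by (simp add: monoid_vec_simps)
    show "x [^]\<^bsub>Zvec m\<^esub> N \<in> generate (Zvec m) (L \<union> S1)" if "x \<in> E" for x
      using N(1) that Ec by (auto simp: monoid_vec_simps J_def)
    show "coprime i N" if "0 < i" "i < c" for i using N(2) that by blast
    show "card R \<le> (2 * D + 3) ^ m" if "Zvec.separated m (generate (Zvec m) (L \<union> S1)) R" "finite R" for R
      using bound that by (simp add: J_def)
  qed
  then obtain T' where T': "T' \<subseteq> E" "generate (Zvec m) ((L \<union> S1) \<union> T') = carrier_vec m"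
    "c ^ card T' \<le> (2 * D + 3) ^ m" by (auto simp: monoid_vec_simps)
  have "real (c ^ card T') \<le> real ((2 * D + 3) ^ m)" using T'(3) by (simp only: of_nat_le_iff)
  then have "log c (real c ^ card T') \<le> log c (real (2 * D + 3) ^ m)"
    using c by (simp only: of_nat_power) (intro log_le_iff[THEN iffD2], auto)
  then have "real (card T') \<le> real m * log c (2 * D + 3)"
    using c by (simp add: log_nat_power)
  moreover have "card (S1 \<union> T') \<le> card S1 + card T'" by (rule card_Un_le)
  then have "real (card (S1 \<union> T')) \<le> real (card S1) + real (card T')" by (simp only: of_nat_le_iff of_nat_add[symmetric])
  ultimately have "real (card (S1 \<union> T')) \<le> real c * s + real m * log c (2 * D + 3)"
    using cardS1 by linarith
  moreover have "finite (S1 \<union> T')" "S1 \<union> T' \<subseteq> carrier_vec m"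
    using finS1 finite_subset[OF T'(1) finE] T'(1) Ec S1c by auto
  moreover have "generate (Zvec m) (f ` {..<m} \<union> (S1 \<union> T')) = carrier_vec m"
    using T'(2) by (simp add: L_def Un_assoc)
  ultimately show ?thesis by (intro exI[of _ "S1 \<union> T'"]) simp
qed

section \<open>From the sandpile group to kernels modulo primes\<close>

definition partner :: "'v set set \<Rightarrow> 'v \<Rightarrow> 'v" where
  "partner M v = (THE u. {v, u} \<in> M)"

lemma partner_edge:
  assumes "M \<in> matchings V" "v \<in> V"
  shows "{v, partner M v} \<in> M"
proof -
  obtain b where b: "{v, b} \<in> M" using matching_partner_ex[OF assms] by blast
  show ?thesis unfolding partner_def
    by (rule theI[of _ b]) (use b matching_partner_unique[OF assms(1)] in auto)
qed

lemma edge_iff_partner: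
  assumes "M \<in> matchings V" "v \<in> V"
  shows "{v, u} \<in> M \<longleftrightarrow> u = partner M v"
  using partner_edge[OF assms] matching_partner_unique[OF assms(1)] by auto

lemma partner_in: "M \<in> matchings V \<Longrightarrow> v \<in> V \<Longrightarrow> partner M v \<in> V"
  using partner_edge matching_edgeD(2) by fast

lemma finite_matching: "finite V \<Longrightarrow> M \<in> matchings V \<Longrightarrow> finite M"
  by (rule finite_subset[of _ "Pow V"]) (auto simp: matchings_def partition_on_def)

lemma sum_count_matching:
  fixes g :: "'v \<Rightarrow> int"
  assumes "finite V" "M \<in> matchings V" "v \<in> V"
  shows "(\<Sum>u\<in>V. int (count (mset_set M) {v, u}) * g u) = g (partner M v)"
proof -
  have "(\<Sum>u\<in>V. int (count (mset_set M) {v, u}) * g u) = (\<Sum>u\<in>V. if u = partner M v then g u else 0)"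
    using edge_iff_partner[OF assms(2,3)] finite_matching[OF assms(1,2)]
    by (intro sum.cong) (auto simp: count_mset_set')
  also have "\<dots> = g (partner M v)"
    using assms(1) partner_in[OF assms(2,3)] by simp
  finally show ?thesis .
qed

lemma sum_count_union:
  fixes g :: "'v \<Rightarrow> int"
  assumes "finite V" "\<And>i. i < d \<Longrightarrow> mm i \<in> matchings V" "v \<in> V"
  shows "(\<Sum>u\<in>V. int (count (\<Sum>i<d. mset_set (mm i)) {v, u}) * g u) = (\<Sum>i<d. g (partner (mm i) v))"
proof -
  have "(\<Sum>u\<in>V. int (count (\<Sum>i<d. mset_set (mm i)) {v, u}) * g u)
      = (\<Sum>u\<in>V. \<Sum>i<d. int (count (mset_set (mm i)) {v, u}) * g u)"
    by (simp add: count_sum sum_distrib_right)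
  also have "\<dots> = (\<Sum>i<d. \<Sum>u\<in>V. int (count (mset_set (mm i)) {v, u}) * g u)"
    by (rule sum.swap)
  also have "\<dots> = (\<Sum>i<d. g (partner (mm i) v))"
    using assms by (intro sum.cong sum_count_matching) auto
  finally show ?thesis .
qed

definition laplacian_kernel :: "nat \<Rightarrow> nat \<Rightarrow> nat \<Rightarrow> nat set multiset \<Rightarrow> (nat \<Rightarrow> int) set" where
  "laplacian_kernel p d n H = {x \<in> {1..n} \<rightarrow>\<^sub>E {0..<int p}.
     \<forall>v\<in>{1..n}. (\<Sum>u=1..n. int (count H {v, u}) * x u) mod int p = (int d * x v) mod int p}"

lemma finite_laplacian_kernel: "finite (laplacian_kernel p d n H)"
  by (rule finite_subset[of _ "{1..n} \<rightarrow>\<^sub>E {0..<int p}"])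
     (auto simp: laplacian_kernel_def intro: finite_PiE)

lemma reduced_laplacian_index:
  assumes "i < m" "j < m"
  shows "reduced_laplacian d (Suc m) H $$ (i, j)
           = int (count H {Suc i, Suc j}) - (if i = j then int d else 0)"
  using assms by (simp add: reduced_laplacian_def mat_delete_def adjacency_matrix_def)

lemma reduced_laplacian_carrier: "reduced_laplacian d (Suc m) H \<in> carrier_mat m m"
proof -
  have "adjacency_matrix (Suc m) H - int d \<cdot>\<^sub>m 1\<^sub>m (Suc m) \<in> carrier_mat (Suc m) (Suc m)"
    by (auto simp: adjacency_matrix_def)
  from mat_delete_carrier[OF this, of m m] show ?thesis by (simp add: reduced_laplacian_def)
qed

text \<open>
  A kernel vector of the reduced Laplacian is extended by 0 at the deleted vertex. Symmetry of the
  adjacency matrix turns the left kernel into the right one. The equation at the deleted vertex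
  follows from the others because the columns of the Laplacian sum to 0.
\<close>

lemma card_left_kernel_le_laplacian_kernel:
  assumes p: "p > 0"
    and deg: "\<And>v. v \<in> {1..Suc m} \<Longrightarrow> (\<Sum>u=1..Suc m. int (count H {v, u})) = int d"
  shows "card (left_kernel p m (Matrix.row (reduced_laplacian d (Suc m) H)))
           \<le> card (laplacian_kernel p d (Suc m) H)"
proof (rule card_inj_on_le[OF _ _ finite_laplacian_kernel])
  let ?f = "Matrix.row (reduced_laplacian d (Suc m) H)"
  let ?h = "\<lambda>y. \<lambda>v\<in>{1..Suc m}. if v = Suc m then 0 else y (v - 1)"
  have f: "?f i $ j = int (count H {Suc i, Suc j}) - (if i = j then int d else 0)"
    if "i < m" "j < m" for i j
    using that reduced_laplacian_carrier[of d m H] reduced_laplacian_index[of i m j d H] by auto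
  show "inj_on ?h (left_kernel p m ?f)"
  proof (rule inj_onI)
    fix y z assume y: "y \<in> left_kernel p m ?f" and z: "z \<in> left_kernel p m ?f" and eq: "?h y = ?h z"
    show "y = z"
    proof (rule PiE_ext)
      show "y \<in> {..<m} \<rightarrow>\<^sub>E {0..<int p}" "z \<in> {..<m} \<rightarrow>\<^sub>E {0..<int p}"
        using y z by (simp_all add: left_kernel_def)
      fix i assume "i \<in> {..<m}"
      then show "y i = z i" using fun_cong[OF eq, of "Suc i"] by simp
    qed
  qed
  show "?h ` left_kernel p m ?f \<subseteq> laplacian_kernel p d (Suc m) H"
  proof
    fix x assume "x \<in> ?h ` left_kernel p m ?f"
    then obtain y where y: "y \<in> left_kernel p m ?f" and x: "x = ?h y" by blast
    have xs: "x (Suc i) = (if i = m then 0 else y i)" if "i < Suc m" for i using that by (simp add: x)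
    have yU: "y \<in> {..<m} \<rightarrow>\<^sub>E {0..<int p}" and ker: "\<And>j. j < m \<Longrightarrow> (\<Sum>i<m. y i * ?f i $ j) mod int p = 0"
      using y by (simp_all add: left_kernel_def)
    \<comment> \<open>the defect in the kernel equation at the vertex \<open>v\<close>\<close>
    define q where "q v = (\<Sum>u=1..Suc m. int (count H {v, u}) * x u) - int d * x v" for v
    have q_lt: "int p dvd q (Suc j)" if j: "j < m" for j
    proof -
      have "q (Suc j) = (\<Sum>i<m. int (count H {Suc j, Suc i}) * y i) - int d * y j"
        using j by (simp add: q_def sum.atLeast1_atMost_eq xs)
      also have "\<dots> = (\<Sum>i<m. y i * ?f i $ j)"
      proof -
        have "(\<Sum>i<m. y i * ?f i $ j)
            = (\<Sum>i<m. int (count H {Suc j, Suc i}) * y i - (if i = j then int d * y i else 0))"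
          using j by (intro sum.cong) (auto simp: f algebra_simps insert_commute)
        also have "\<dots> = (\<Sum>i<m. int (count H {Suc j, Suc i}) * y i) - int d * y j"
          using j by (simp add: sum_subtractf)
        finally show ?thesis by simp
      qed
      finally show ?thesis using ker[OF j] by (simp add: dvd_eq_mod_eq_0)
    qed
    have "(\<Sum>v=1..Suc m. q v) = 0"
    proof -
      have "(\<Sum>v=1..Suc m. \<Sum>u=1..Suc m. int (count H {v, u}) * x u)
          = (\<Sum>u=1..Suc m. \<Sum>v=1..Suc m. int (count H {u, v}) * x u)"
        by (subst sum.swap) (simp add: insert_commute)
      also have "\<dots> = (\<Sum>u=1..Suc m. int d * x u)"
        by (intro sum.cong) (simp_all only: sum_distrib_right[symmetric] deg)
      finally show ?thesis unfolding q_def sum_subtractf by simp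
    qed
    then have "q (Suc m) = - (\<Sum>j<m. q (Suc j))" by (simp add: sum.atLeast1_atMost_eq)
    moreover have "int p dvd (\<Sum>j<m. q (Suc j))" using q_lt by (intro dvd_sum) simp
    ultimately have q_m: "int p dvd q (Suc m)" by simp
    have "int p dvd q v" if "v \<in> {1..Suc m}" for v
      using that q_m q_lt[of "v - 1"] by (cases "v = Suc m") auto
    then have "\<forall>v\<in>{1..Suc m}. (\<Sum>u=1..Suc m. int (count H {v, u}) * x u) mod int p = (int d * x v) mod int p"
      by (simp only: q_def mod_eq_dvd_iff ball_simps) blast
    moreover have "x \<in> {1..Suc m} \<rightarrow>\<^sub>E {0..<int p}"
      unfolding x restrict_PiE_iff
    proof
      fix v assume "v \<in> {1..Suc m}"
      then have "v \<noteq> Suc m \<Longrightarrow> v - 1 \<in> {..<m}" by auto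
      then show "(if v = Suc m then 0 else y (v - 1)) \<in> {0..<int p}"
        using PiE_mem[OF yU, of "v - 1"] p by (cases "v = Suc m") simp_all
    qed
    ultimately show "x \<in> laplacian_kernel p d (Suc m) H" by (simp only: laplacian_kernel_def mem_Collect_eq)
  qed
qed

text \<open>
  The \<open>\<ell>\<^sup>1\<close>-norm of a column of the reduced Laplacian is at most \<open>2 d\<close>: the off-diagonal part contributes
  at most the degree \<open>d\<close>, the diagonal at most another \<open>d\<close>. So the bound for lattices applies with
  \<open>D = 2 d\<close>.
\<close>

lemma group_rank_sandpile_le:
  fixes s :: real
  assumes mm: "\<And>i. i < d \<Longrightarrow> mm i \<in> perfect_matchings n" and H: "H = (\<Sum>i<d. mset_set (mm i))"
    and n: "n \<ge> 1" and s: "s \<ge> 0" and c: "c \<ge> 3"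
    and ker: "\<And>p. Factorial_Ring.prime p \<Longrightarrow> p < c \<Longrightarrow> real (card (laplacian_kernel p d n H)) \<le> 2 powr s"
  shows "real (group_rank (sandpile_group d n H)) \<le> real c * s + real n * log c (4 * d + 3)"
proof -
  obtain m where m: "n = Suc m" using n by (cases n) auto
  have mm': "\<And>i. i < d \<Longrightarrow> mm i \<in> matchings {1..Suc m}"
    using mm by (simp add: perfect_matchings_eq m)
  have deg: "(\<Sum>u=1..Suc m. int (count H {v, u})) = int d" if "v \<in> {1..Suc m}" for v
    using sum_count_union[of "{1..Suc m}" d mm v "\<lambda>_. 1"] mm' that by (simp add: H)
  define L where "L = reduced_laplacian d n H"
  have L: "L \<in> carrier_mat m m" unfolding L_def m by (rule reduced_laplacian_carrier)
  have rowc: "Matrix.row L i \<in> carrier_vec m" if "i < m" for i using L by auto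
  have col: "(\<Sum>i<m. \<bar>Matrix.row L i $ j\<bar>) \<le> int (2 * d)" if j: "j < m" for j
  proof -
    have "(\<Sum>i<m. \<bar>Matrix.row L i $ j\<bar>)
        \<le> (\<Sum>i<m. int (count H {Suc j, Suc i}) + (if i = j then int d else 0))"
    proof (rule sum_mono)
      fix i assume "i \<in> {..<m}"
      then have "Matrix.row L i $ j = int (count H {Suc i, Suc j}) - (if i = j then int d else 0)"
        using L j reduced_laplacian_index[of i m j d H] by (auto simp: L_def m)
      then show "\<bar>Matrix.row L i $ j\<bar> \<le> int (count H {Suc j, Suc i}) + (if i = j then int d else 0)"
        by (auto simp: insert_commute)
    qed
    also have "\<dots> = (\<Sum>i<m. int (count H {Suc j, Suc i})) + int d" using j by (simp add: sum.distrib)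
    also have "(\<Sum>i<m. int (count H {Suc j, Suc i})) \<le> (\<Sum>i<Suc m. int (count H {Suc j, Suc i}))" by simp
    also have "\<dots> = int d" using deg[of "Suc j"] j by (simp add: sum.atLeast1_atMost_eq)
    finally show ?thesis by simp
  qed
  have lker: "real (card (left_kernel p m (Matrix.row L))) \<le> 2 powr s"
    if p: "Factorial_Ring.prime p" "p < c" for p
  proof -
    have "card (left_kernel p m (Matrix.row L)) \<le> card (laplacian_kernel p d n H)"
      using card_left_kernel_le_laplacian_kernel[OF prime_gt_0_nat[OF p(1)] deg] by (simp add: L_def m)
    then show ?thesis using ker[OF p] by linarith
  qed
  obtain S where S: "S \<subseteq> carrier_vec m" "finite S"
    "generate (Zvec m) (Matrix.row L ` {..<m} \<union> S) = carrier_vec m"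
    "real (card S) \<le> real c * s + real m * log c (2 * (2 * d) + 3)"
    using lattice_generators[OF rowc col s c lker] by blast
  have rows: "set (Matrix.rows L) = Matrix.row L ` {..<m}"
    using L by (auto simp: Matrix.rows_def)
  have "group_rank (Zvec m Mod generate (Zvec m) (Matrix.row L ` {..<m})) \<le> card S"
    using S rowc by (intro group_rank_quotient_le comm_group_vec) (auto simp: monoid_vec_simps)
  then have "group_rank (sandpile_group d n H) \<le> card S"
    unfolding sandpile_group_def row_subgroup_def L_def[symmetric] rows by (simp add: m)
  then have "real (group_rank (sandpile_group d n H)) \<le> real c * s + real m * log c (2 * (2 * d) + 3)"
    using S(4) by linarith
  also have "real m * log c (2 * (2 * d) + 3) \<le> real n * log c (4 * d + 3)"
    using c by (auto simp: m intro!: mult_right_mono)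
  finally show ?thesis by simp
qed

section \<open>The expected size of the kernel\<close>

lemma card_coincidences:
  assumes "finite A" "finite B" "finite Y" "f ` A \<subseteq> Y"
  shows "card {(a, b) \<in> A \<times> B. f a = g b} = (\<Sum>y\<in>Y. card {a \<in> A. f a = y} * card {b \<in> B. g b = y})"
proof -
  have "{(a, b) \<in> A \<times> B. f a = g b} = (\<Union>y\<in>Y. {a \<in> A. f a = y} \<times> {b \<in> B. g b = y})"
    using assms(4) by auto
  also have "card \<dots> = (\<Sum>y\<in>Y. card ({a \<in> A. f a = y} \<times> {b \<in> B. g b = y}))"
    using assms by (intro card_UN_disjoint) auto
  finally show ?thesis by (simp add: card_cartesian_product)
qed

text \<open>
  Cauchy--Schwarz, in the form \<open>2 u v \<le> u\<^sup>2 + v\<^sup>2\<close> applied to the sizes of the fibres. The hypothesis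
  says that \<open>f\<close> and \<open>g\<close> have the same fibres up to relabelling.
\<close>

lemma card_coincidences_le:
  assumes A: "finite A" and fg: "\<And>a b. a \<in> A \<Longrightarrow> b \<in> A \<Longrightarrow> g a = g b \<longleftrightarrow> f a = f b"
  shows "card {(a, b) \<in> A \<times> A. f a = g b} \<le> card {(a, b) \<in> A \<times> A. f a = f b}"
proof -
  define Y where "Y = f ` A \<union> g ` A"
  have Y: "finite Y" "f ` A \<subseteq> Y" "g ` A \<subseteq> Y" using A by (auto simp: Y_def)
  define F where "F y = card {a \<in> A. f a = y}" for y
  define K where "K y = card {a \<in> A. g a = y}" for y
  have "2 * card {(a, b) \<in> A \<times> A. f a = g b} = (\<Sum>y\<in>Y. 2 * (F y * K y))"
    unfolding card_coincidences[OF A A Y(1,2)] F_def K_def sum_distrib_left ..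
  also have "\<dots> \<le> (\<Sum>y\<in>Y. F y * F y + K y * K y)"
  proof (rule sum_mono)
    fix y
    have "real (2 * (F y * K y)) \<le> real (F y * F y + K y * K y)"
      using sum_squares_bound[of "real (F y)" "real (K y)"] by (simp add: power2_eq_square)
    then show "2 * (F y * K y) \<le> F y * F y + K y * K y" by (simp only: of_nat_le_iff)
  qed
  also have "\<dots> = card {(a, b) \<in> A \<times> A. f a = f b} + card {(a, b) \<in> A \<times> A. g a = g b}"
    unfolding card_coincidences[OF A A Y(1,2)] card_coincidences[OF A A Y(1,3)] F_def K_def sum.distrib ..
  also have "{(a, b) \<in> A \<times> A. g a = g b} = {(a, b) \<in> A \<times> A. f a = f b}" using fg by auto
  finally show ?thesis by simp
qed

text \<open>
  The first moment of the kernel size, as a sum over all \<open>d\<close>-tuples of matchings. For given \<open>x\<close> and given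
  matchings with indices from 2 on, the kernel condition reads \<open>f x (mm 0) = g (mm 1)\<close>, where
  \<open>f x a\<close> is \<open>x\<close> permuted by \<open>a\<close>, and \<open>g\<close> differs from \<open>f x\<close> by a reflection modulo \<open>p\<close>. Hence the
  preceding lemma replaces it by \<open>f x (mm 0) = f x (mm 1)\<close>, that is, by agreement of two matchings
  on \<open>x\<close>, for which the count is known once the sum over \<open>x\<close> is exchanged with that over \<open>mm 0\<close>.
\<close>

lemma sum_card_kernel_le:
  fixes d p k :: nat
  assumes d: "d \<ge> 2" and p: "p > 0"
  defines "PM \<equiv> perfect_matchings (2 * k)"
  shows "(\<Sum>mm\<in>PiE_dflt {..<d} {} (\<lambda>_. PM). card (laplacian_kernel p d (2 * k) (\<Sum>i<d. mset_set (mm i))))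
           \<le> card PM ^ (d - 1) * (\<Prod>j<k. p\<^sup>2 + 2 * j)"
proof -
  define V where "V = {1..2 * k}"
  define U where "U = (V \<rightarrow>\<^sub>E {0..<int p})"
  have PM: "PM = matchings V" by (simp add: PM_def V_def perfect_matchings_eq)
  have finV: "finite V" "card V = 2 * k" by (simp_all add: V_def)
  have finPM: "finite PM" using finV finite_matchings by (simp add: PM)
  have finU: "finite U" by (auto simp: U_def V_def intro: finite_PiE)
  define MM where "MM = PiE_dflt {..<d} {} (\<lambda>_. PM)"
  define M2 where "M2 = PiE_dflt {2..<d} {} (\<lambda>_. PM)"
  have finMM: "finite MM" "finite M2" using finPM by (auto simp: MM_def M2_def)
  have cM2: "card M2 = card PM ^ (d - 2)" using finPM by (simp add: M2_def card_PiE_dflt)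
  define cond where "cond mm x \<longleftrightarrow> (\<forall>v\<in>V. (\<Sum>i<d. x (partner (mm i) v)) mod int p = (int d * x v) mod int p)"
    for mm :: "nat \<Rightarrow> nat set set" and x
  define f where "f x a = (\<lambda>v\<in>V. x (partner a v))" for x :: "nat \<Rightarrow> int" and a
  have ker: "laplacian_kernel p d (2 * k) (\<Sum>i<d. mset_set (mm i)) = {x \<in> U. cond mm x}" if "mm \<in> MM" for mm
  proof -
    have "(\<Sum>u\<in>V. int (count (\<Sum>i<d. mset_set (mm i)) {v, u}) * x u) = (\<Sum>i<d. x (partner (mm i) v))"
      if "v \<in> V" for v x
      using \<open>mm \<in> MM\<close> that by (intro sum_count_union finV) (auto simp: MM_def PiE_dflt_def PM)
    then show ?thesis by (auto simp: laplacian_kernel_def cond_def U_def V_def)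
  qed
  have fix_x: "card {mm \<in> MM. cond mm x} \<le> card PM ^ (d - 2) * card {(a, b) \<in> PM \<times> PM. f x a = f x b}"
    if x: "x \<in> U" for x
  proof -
    \<comment> \<open>what \<open>x\<close> permuted by the matching \<open>mm 0\<close> has to be if \<open>mm 1\<close> is \<open>b\<close> and the others are \<open>r\<close>\<close>
    define g where "g r b = (\<lambda>v\<in>V. (int d * x v - (\<Sum>i\<in>{2..<d}. x (partner (r i) v)) - x (partner b v)) mod int p)"
      for r :: "nat \<Rightarrow> nat set set" and b
    have xp: "x (partner a v) mod int p = x (partner a v)" if "a \<in> PM" "v \<in> V" for a v
      using PiE_mem[OF x[unfolded U_def], of "partner a v"] partner_in[of a V v] that by (simp add: PM)
    have g_eq: "g r a = g r b \<longleftrightarrow> f x a = f x b" if "a \<in> PM" "b \<in> PM" for r a b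
    proof -
      have "g r a v = g r b v \<longleftrightarrow> f x a v = f x b v" for v
      proof (cases "v \<in> V")
        case True
        have "g r a v = g r b v \<longleftrightarrow> int p dvd x (partner b v) - x (partner a v)"
          using True by (simp add: g_def mod_eq_dvd_iff)
        also have "\<dots> \<longleftrightarrow> x (partner b v) = x (partner a v)"
          using xp that True by (metis mod_eq_dvd_iff)
        finally show ?thesis using True by (auto simp: f_def)
      qed (simp add: f_def g_def)
      then show ?thesis by (simp only: fun_eq_iff)
    qed
    let ?h = "\<lambda>mm. (mm(0 := {}, 1 := {}), (mm 0, mm 1))"
    let ?S = "SIGMA r:M2. {(a, b) \<in> PM \<times> PM. f x a = g r b}"
    have "inj_on ?h {mm \<in> MM. cond mm x}"
    proof (rule inj_onI)
      fix r s :: "nat \<Rightarrow> nat set set" assume eq: "?h r = ?h s"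
      then have rs: "r(0 := {}, 1 := {}) = s(0 := {}, 1 := {})" "r 0 = s 0" "r 1 = s 1" by simp_all
      show "r = s"
      proof (rule ext)
        fix i :: nat
        show "r i = s i" using fun_cong[OF rs(1), of i] rs(2,3)
          by (cases "i = 0 \<or> i = 1") auto
      qed
    qed
    moreover have "?h ` {mm \<in> MM. cond mm x} \<subseteq> ?S"
    proof
      fix z assume "z \<in> ?h ` {mm \<in> MM. cond mm x}"
      then obtain mm where mm: "mm \<in> MM" "cond mm x" and z: "z = ?h mm" by auto
      let ?r = "mm(0 := {}, 1 := {})"
      have "?r \<in> M2" using mm(1) by (auto simp: MM_def M2_def PiE_dflt_def)
      moreover have m01: "mm 0 \<in> PM" "mm 1 \<in> PM" using mm(1) d by (auto simp: MM_def PiE_dflt_def)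
      moreover have "f x (mm 0) v = g ?r (mm 1) v" for v
      proof (cases "v \<in> V")
        case True
        have "{..<d} = insert 0 (insert 1 {2..<d})" using d by auto
        then have "(\<Sum>i<d. x (partner (mm i) v))
            = x (partner (mm 0) v) + (x (partner (mm 1) v) + (\<Sum>i\<in>{2..<d}. x (partner (mm i) v)))"
          by simp
        moreover have "(\<Sum>i\<in>{2..<d}. x (partner (?r i) v)) = (\<Sum>i\<in>{2..<d}. x (partner (mm i) v))"
          by (intro sum.cong) auto
        moreover have "int p dvd (\<Sum>i<d. x (partner (mm i) v)) - int d * x v"
          using mm(2) True by (simp add: cond_def mod_eq_dvd_iff)
        ultimately have "int p dvd x (partner (mm 0) v) -
            (int d * x v - (\<Sum>i\<in>{2..<d}. x (partner (?r i) v)) - x (partner (mm 1) v))"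
          by (simp only: algebra_simps)
        then have "x (partner (mm 0) v) mod int p = g ?r (mm 1) v"
          using True by (simp only: g_def mod_eq_dvd_iff restrict_apply' )
        then show ?thesis using True xp[OF m01(1) True] by (simp add: f_def)
      qed (simp add: f_def g_def)
      ultimately show "z \<in> ?S" unfolding z by (auto intro!: ext)
    qed
    moreover have finS: "finite {(a, b) \<in> PM \<times> PM. f x a = g r b}" for r
      by (rule finite_subset[of _ "PM \<times> PM"]) (use finPM in auto)
    ultimately have "card {mm \<in> MM. cond mm x} \<le> card ?S"
      using finMM by (intro card_inj_on_le) auto
    also have "\<dots> = (\<Sum>r\<in>M2. card {(a, b) \<in> PM \<times> PM. f x a = g r b})"
      using finMM finS by (intro card_SigmaI) auto
    also have "\<dots> \<le> (\<Sum>r\<in>M2. card {(a, b) \<in> PM \<times> PM. f x a = f x b})"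
      by (intro sum_mono card_coincidences_le finPM g_eq)
    finally show ?thesis by (simp add: cM2)
  qed
  have cU: "card {z \<in> U. Q z} = (\<Sum>z\<in>U. of_bool (Q z))" for Q
    using finU by (simp add: of_bool_def sum.If_cases Int_def)
  have cMM: "card {z \<in> MM. Q z} = (\<Sum>z\<in>MM. of_bool (Q z))" for Q
    using finMM by (simp add: of_bool_def sum.If_cases Int_def)
  have pairs: "card {(a, b) \<in> PM \<times> PM. f x a = f x b} = (\<Sum>a\<in>PM. \<Sum>b\<in>PM. of_bool (f x a = f x b))" for x
  proof -
    have "card {z \<in> PM \<times> PM. f x (fst z) = f x (snd z)} = (\<Sum>z\<in>PM \<times> PM. of_bool (f x (fst z) = f x (snd z)))"
      using finPM by (simp add: of_bool_def sum.If_cases Int_def)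
    also have "{z \<in> PM \<times> PM. f x (fst z) = f x (snd z)} = {(a, b) \<in> PM \<times> PM. f x a = f x b}" by auto
    finally show ?thesis by (simp add: sum.cartesian_product split_beta)
  qed
  have per_a: "(\<Sum>b\<in>PM. \<Sum>x\<in>U. of_bool (f x a = f x b)) \<le> (\<Prod>j<k. p\<^sup>2 + 2 * j)"
    if a: "a \<in> PM" for a
  proof -
    have "(\<Sum>b\<in>PM. \<Sum>x\<in>U. of_bool (f x a = f x b)) = card (SIGMA b:PM. {x \<in> U. f x a = f x b})"
      using finPM finU by (simp add: cU[symmetric])
    also have "\<dots> \<le> card {(M, x). M \<in> matchings V \<and> x \<in> V \<rightarrow>\<^sub>E {0..<int p} \<and> agree a M x}"
    proof (rule card_mono)
      show "finite {(M, x). M \<in> matchings V \<and> x \<in> V \<rightarrow>\<^sub>E {0..<int p} \<and> agree a M x}"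
        by (rule finite_subset[of _ "PM \<times> U"]) (use finPM finU in \<open>auto simp: PM U_def\<close>)
      have "agree a b x" if b: "b \<in> PM" and eq: "f x a = f x b" for b x
        unfolding agree_def
      proof (intro allI impI)
        fix v r s assume e: "{v, r} \<in> a" "{v, s} \<in> b"
        have v: "v \<in> V" using matching_edgeD(1)[OF _ e(1)] a by (simp add: PM)
        have "r = partner a v" "s = partner b v"
          using edge_iff_partner[of a V v r] edge_iff_partner[of b V v s] e v a b by (simp_all add: PM)
        then show "x r = x s" using fun_cong[OF eq, of v] v by (simp add: f_def)
      qed
      then show "(SIGMA b:PM. {x \<in> U. f x a = f x b})
          \<subseteq> {(M, x). M \<in> matchings V \<and> x \<in> V \<rightarrow>\<^sub>E {0..<int p} \<and> agree a M x}"
        by (auto simp: PM U_def)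
    qed
    also have "\<dots> \<le> (\<Prod>j<k. (card {0..<int p})\<^sup>2 + 2 * j)"
      using a by (intro card_agree_le finV) (auto simp: PM)
    finally show ?thesis by simp
  qed
  have "(\<Sum>mm\<in>MM. card (laplacian_kernel p d (2 * k) (\<Sum>i<d. mset_set (mm i))))
      = (\<Sum>mm\<in>MM. card {x \<in> U. cond mm x})"
    by (intro sum.cong refl) (simp only: ker)
  also have "\<dots> = (\<Sum>x\<in>U. card {mm \<in> MM. cond mm x})"
    unfolding cU cMM by (rule sum.swap)
  also have "\<dots> \<le> (\<Sum>x\<in>U. card PM ^ (d - 2) * card {(a, b) \<in> PM \<times> PM. f x a = f x b})"
    by (intro sum_mono fix_x)
  also have "\<dots> = card PM ^ (d - 2) * (\<Sum>x\<in>U. \<Sum>a\<in>PM. \<Sum>b\<in>PM. of_bool (f x a = f x b))"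
    by (simp only: pairs sum_distrib_left)
  also have "(\<Sum>x\<in>U. \<Sum>a\<in>PM. \<Sum>b\<in>PM. of_bool (f x a = f x b) :: nat)
      = (\<Sum>a\<in>PM. \<Sum>b\<in>PM. \<Sum>x\<in>U. of_bool (f x a = f x b))"
    by (subst sum.swap, intro sum.cong refl, rule sum.swap)
  also have "\<dots> \<le> (\<Sum>a\<in>PM. (\<Prod>j<k. p\<^sup>2 + 2 * j))"
    by (intro sum_mono per_a)
  also have "card PM ^ (d - 2) * (\<Sum>a\<in>PM. (\<Prod>j<k. p\<^sup>2 + 2 * j))
      = card PM ^ (d - 1) * (\<Prod>j<k. p\<^sup>2 + 2 * j)"
  proof -
    have "d - 1 = Suc (d - 2)" using d by simp
    then show ?thesis by simp
  qed
  finally show ?thesis by (simp add: MM_def)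
qed

section \<open>Summability and almost sure convergence\<close>

text \<open>
  Markov's inequality. One factor \<open>1 / card PM\<close> is left after the cancellation of the powers of the
  number of matchings, and it is estimated by \<open>card_matchings_ge\<close>.
\<close>

lemma prob_kernel_large_le:
  assumes d: "d \<ge> 2" and p: "p > 0" and T: "T > 0"
  shows "measure_pmf.prob (random_matching_graph d (2 * k))
           {H. real (card (laplacian_kernel p d (2 * k) H)) > T}
         \<le> (\<Prod>j<k. (real p ^ 2 + 2 * real j) / (2 * real j + 1)) / T"
proof -
  define PM where "PM = perfect_matchings (2 * k)"
  define MM where "MM = PiE_dflt {..<d} {} (\<lambda>_. PM)"
  define N where "N mm = card (laplacian_kernel p d (2 * k) (\<Sum>i<d. mset_set (mm i)))"
    for mm :: "nat \<Rightarrow> nat set set"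
  define g where "g = (\<Prod>j<k. p\<^sup>2 + 2 * j)"
  define l where "l = (\<Prod>j<k. 2 * j + 1)"
  have PM: "finite PM" "PM \<noteq> {}"
    using finite_perfect_matchings perfect_matchings_nonempty by (auto simp: PM_def)
  have l: "l \<le> card PM" "l > 0"
    using card_matchings_ge[of "{1..2 * k}" k] by (auto simp: l_def PM_def perfect_matchings_eq)
  have cMM: "card MM = card PM ^ d" using PM by (simp add: MM_def card_PiE_dflt)
  have cPM: "card PM > 0" using PM by (simp add: card_gt_0_iff)
  have finMM: "finite MM" using PM by (auto simp: MM_def)
  have neMM: "MM \<noteq> {}" using cMM cPM by auto
  have rmg: "random_matching_graph d (2 * k) = map_pmf (\<lambda>mm. \<Sum>i<d. mset_set (mm i)) (pmf_of_set MM)"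
    unfolding random_matching_graph_def MM_def PM_def[symmetric] using PM by (subst Pi_pmf_of_set) auto
  let ?B = "{mm \<in> MM. real (N mm) > T}"
  have "T * real (card ?B) = (\<Sum>mm\<in>?B. T)" by simp
  also have "\<dots> \<le> (\<Sum>mm\<in>?B. real (N mm))" by (intro sum_mono) auto
  also have "\<dots> \<le> (\<Sum>mm\<in>MM. real (N mm))" using finMM by (intro sum_mono2) auto
  also have "\<dots> = real (\<Sum>mm\<in>MM. N mm)" by simp
  also have "\<dots> \<le> real (card PM ^ (d - 1) * g)"
    using sum_card_kernel_le[OF d p, of k]
    by (simp only: of_nat_le_iff N_def MM_def PM_def g_def)
  finally have B: "T * real (card ?B) \<le> real (card PM ^ (d - 1)) * real g" by simp
  have "measure_pmf.prob (random_matching_graph d (2 * k))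
      {H. real (card (laplacian_kernel p d (2 * k) H)) > T} = real (card ?B) / real (card MM)"
    unfolding rmg using finMM neMM
    by (simp add: measure_map_pmf measure_pmf_of_set vimage_def N_def Int_def)
  also have "\<dots> \<le> (real (card PM ^ (d - 1)) * real g / T) / real (card MM)"
    using B T by (intro divide_right_mono) (simp_all add: pos_le_divide_eq mult.commute)
  also have "\<dots> = real g / real (card PM) / T"
  proof -
    have "d = Suc (d - 1)" using d by simp
    then have "card MM = card PM ^ (d - 1) * card PM" unfolding cMM by (metis power_Suc2)
    then show ?thesis using cPM T by (simp add: field_simps)
  qed
  also have "\<dots> \<le> real g / real l / T"
    using l T by (intro divide_right_mono divide_left_mono) auto
  also have "real g / real l = (\<Prod>j<k. (real p ^ 2 + 2 * real j) / (2 * real j + 1))"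
    by (simp add: g_def l_def prod_dividef add.commute)
  finally show ?thesis .
qed

text \<open>
  Consecutive products have a ratio that tends to 1 (they grow like a power of \<open>k\<close>), so the
  exponential denominator dominates.
\<close>

lemma summable_kernel_bound:
  fixes \<delta> :: real
  assumes "\<delta> > 0"
  shows "summable (\<lambda>k. (\<Prod>j<k. (real p ^ 2 + 2 * real j) / (2 * real j + 1)) / 2 powr (\<delta> * real (2 * k)))"
    (is "summable ?f")
proof -
  define q where "q = 2 powr (- (2 * \<delta>))"
  have q: "0 < q" "q < 1" using assms by (auto simp: q_def powr_less_one)
  have "(\<lambda>k. (real p ^ 2 + 2 * real k) / (2 * real k + 1)) \<longlonglongrightarrow> 1" by real_asymp
  then have "(\<lambda>k. (real p ^ 2 + 2 * real k) / (2 * real k + 1) * q) \<longlonglongrightarrow> 1 * q"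
    by (intro tendsto_mult tendsto_const)
  then have "\<forall>\<^sub>F k in sequentially. (real p ^ 2 + 2 * real k) / (2 * real k + 1) * q < (1 + q) / 2"
    using q by (intro order_tendstoD) auto
  then obtain N where N: "\<And>k. k \<ge> N \<Longrightarrow> (real p ^ 2 + 2 * real k) / (2 * real k + 1) * q < (1 + q) / 2"
    by (auto simp: eventually_sequentially)
  show ?thesis
  proof (rule summable_ratio_test[of "(1 + q) / 2" N])
    show "(1 + q) / 2 < 1" using q by simp
    fix k assume k: "N \<le> k"
    have pos: "?f k \<ge> 0" for k by (auto intro!: divide_nonneg_nonneg prod_nonneg)
    have "2 powr (\<delta> * real (2 * Suc k)) = 2 powr (\<delta> * real (2 * k)) / q"
      by (simp add: q_def powr_diff[symmetric] algebra_simps)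
    moreover have "(x * y) / (D / q) = x / D * (y * q)" for x y D :: real by simp
    ultimately have "?f (Suc k) = ?f k * ((real p ^ 2 + 2 * real k) / (2 * real k + 1) * q)"
      by (simp only: prod.lessThan_Suc)
    also have "\<dots> \<le> ?f k * ((1 + q) / 2)"
      using N[OF k] by (intro mult_left_mono pos) simp
    finally show "norm (?f (Suc k)) \<le> (1 + q) / 2 * norm (?f k)"
      using pos[of k] pos[of "Suc k"] by (simp only: real_norm_def abs_of_nonneg mult.commute)
  qed
qed

text \<open>
  The cutoff \<open>c\<close> is taken so large that the contribution \<open>n log\<^sub>c (4 d + 3)\<close> of the primes beyond \<open>c\<close> is
  at most \<open>\<epsilon> n / 2\<close>. A rank above \<open>\<epsilon> n\<close> then forces one of the finitely many kernels modulo primes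
  below \<open>c\<close> to exceed \<open>2\<^sup>\<delta>\<^sup>n\<close> with \<open>c \<delta> = \<epsilon> / 2\<close>.
\<close>

lemma prob_rank_large_summable:
  fixes \<epsilon> :: real
  assumes d: "d \<ge> 2" and e: "\<epsilon> > 0"
  shows "summable (\<lambda>k. measure_pmf.prob (random_matching_graph d (2 * Suc k))
           {H. real (group_rank (sandpile_group d (2 * Suc k) H)) > \<epsilon> * real (2 * Suc k)})"
proof -
  obtain c0 :: nat where c0: "real (4 * d + 3) powr (2 / \<epsilon>) \<le> real c0"
    using real_arch_simple by blast
  define c where "c = max c0 3"
  have c: "c \<ge> 3" "real (4 * d + 3) powr (2 / \<epsilon>) \<le> real c" using c0 by (auto simp: c_def)
  have "ln (real (4 * d + 3) powr (2 / \<epsilon>)) \<le> ln (real c)" using c by (subst ln_le_cancel_iff) auto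
  then have "2 / \<epsilon> * ln (real (4 * d + 3)) \<le> ln (real c)" by (simp add: ln_powr)
  moreover have "ln (real c) > 0" using c by simp
  ultimately have logc: "log (real c) (real (4 * d + 3)) \<le> \<epsilon> / 2"
    using e by (simp add: log_def field_simps)
  define \<delta> where "\<delta> = \<epsilon> / (2 * real c)"
  have \<delta>: "\<delta> > 0" "real c * \<delta> = \<epsilon> / 2" using e c by (auto simp: \<delta>_def)
  define P where "P = {p::nat. Factorial_Ring.prime p \<and> p < c}"
  have finP: "finite P" by (rule finite_subset[of _ "{..<c}"]) (auto simp: P_def)
  define b where "b p k = (\<Prod>j<k. (real p ^ 2 + 2 * real j) / (2 * real j + 1)) / 2 powr (\<delta> * real (2 * k))"
    for p k :: nat
  have prob_le: "measure_pmf.prob (random_matching_graph d (2 * k))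
      {H. real (group_rank (sandpile_group d (2 * k) H)) > \<epsilon> * real (2 * k)} \<le> (\<Sum>p\<in>P. b p k)"
    if k: "k \<ge> 1" for k
  proof -
    let ?Q = "random_matching_graph d (2 * k)"
    let ?B = "{H. real (group_rank (sandpile_group d (2 * k) H)) > \<epsilon> * real (2 * k)}"
    let ?K = "\<lambda>p. {H. real (card (laplacian_kernel p d (2 * k) H)) > 2 powr (\<delta> * real (2 * k))}"
    have "?B \<inter> set_pmf ?Q \<subseteq> (\<Union>p\<in>P. ?K p)"
    proof
      fix H assume H: "H \<in> ?B \<inter> set_pmf ?Q"
      have "set_pmf (pmf_of_set (perfect_matchings (2 * k))) = perfect_matchings (2 * k)"
        using finite_perfect_matchings perfect_matchings_nonempty by (intro set_pmf_of_set) auto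
      then obtain mm where mm: "\<And>i. i < d \<Longrightarrow> mm i \<in> perfect_matchings (2 * k)"
        and Heq: "H = (\<Sum>i<d. mset_set (mm i))"
        using H by (auto simp: random_matching_graph_def set_Pi_pmf PiE_dflt_def)
      show "H \<in> (\<Union>p\<in>P. ?K p)"
      proof (rule ccontr)
        assume no: "H \<notin> (\<Union>p\<in>P. ?K p)"
        have "real (group_rank (sandpile_group d (2 * k) H))
            \<le> real c * (\<delta> * real (2 * k)) + real (2 * k) * log c (4 * d + 3)"
        proof (rule group_rank_sandpile_le[OF mm Heq _ _ c(1)])
          show "real (card (laplacian_kernel p d (2 * k) H)) \<le> 2 powr (\<delta> * real (2 * k))"
            if "Factorial_Ring.prime p" "p < c" for p
            using no that by (auto simp: P_def not_less)
        qed (use k \<delta> in auto)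
        also have "\<dots> \<le> (\<epsilon> / 2) * real (2 * k) + real (2 * k) * (\<epsilon> / 2)"
          using \<delta>(2) logc by (intro add_mono mult_left_mono) (auto simp: mult.assoc[symmetric])
        finally show False using H by (simp add: algebra_simps)
      qed
    qed
    then have "measure_pmf.prob ?Q (?B \<inter> set_pmf ?Q) \<le> measure_pmf.prob ?Q (\<Union>p\<in>P. ?K p)"
      by (intro measure_pmf.finite_measure_mono) auto
    also have "\<dots> \<le> (\<Sum>p\<in>P. measure_pmf.prob ?Q (?K p))"
      using finP by (intro measure_pmf.finite_measure_subadditive_finite) auto
    also have "\<dots> \<le> (\<Sum>p\<in>P. b p k)"
      unfolding b_def using d prime_gt_0_nat
      by (intro sum_mono prob_kernel_large_le) (auto simp: P_def)
    finally show ?thesis by (simp add: measure_Int_set_pmf)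
  qed
  have "summable (\<lambda>k. \<Sum>p\<in>P. b p k)"
    unfolding b_def by (intro summable_sum summable_kernel_bound \<delta>)
  then have "summable (\<lambda>k. \<Sum>p\<in>P. b p (Suc k))" by (subst summable_Suc_iff)
  then show ?thesis
    by (rule summable_comparison_test'[where N = 0]) (use prob_le[of "Suc _"] in simp)
qed

theorem theorem1p9:
  fixes M :: "'a measure"
    and d :: nat
    and H :: "nat \<Rightarrow> 'a \<Rightarrow> nat set multiset"
  assumes "prob_space M"
    and "d \<ge> 3"
    and "prob_space.indep_vars M (\<lambda>_. count_space UNIV) H {n. even n \<and> n \<ge> 2}"
    and "\<And>n. even n \<Longrightarrow> n \<ge> 2 \<Longrightarrow>
           distr M (count_space UNIV) (H n) = measure_pmf (random_matching_graph d n)"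
  shows "AE \<omega> in M.
           (\<lambda>k. real (group_rank (sandpile_group d (2 * k) (H (2 * k) \<omega>))) / real (2 * k))
             \<longlonglongrightarrow> 0"
proof -
  interpret prob_space M by fact
  \<comment> \<open>the index is shifted by one because the hypotheses determine the law of \<open>H n\<close> for \<open>n \<ge> 2\<close> only\<close>
  have meas: "H (2 * Suc k) \<in> measurable M (count_space UNIV)" for k
    using assms(3) unfolding indep_vars_def by auto
  define r where "r k G = real (group_rank (sandpile_group d (2 * Suc k) G)) / real (2 * Suc k)" for k G
  define A where "A \<epsilon> k = H (2 * Suc k) -` {G. r k G > \<epsilon>} \<inter> space M" for \<epsilon> :: real and k
  have A_sets: "A \<epsilon> k \<in> sets M" for \<epsilon> k
    unfolding A_def by (rule measurable_sets[OF meas]) simp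
  have A_prob: "measure M (A \<epsilon> k) = measure_pmf.prob (random_matching_graph d (2 * Suc k))
      {G. real (group_rank (sandpile_group d (2 * Suc k) G)) > \<epsilon> * real (2 * Suc k)}" for \<epsilon> k
  proof -
    have "measure M (A \<epsilon> k) = measure (distr M (count_space UNIV) (H (2 * Suc k))) {G. r k G > \<epsilon>}"
      unfolding A_def by (rule measure_distr[OF meas, symmetric]) simp
    also have "{G. r k G > \<epsilon>} = {G. real (group_rank (sandpile_group d (2 * Suc k) G)) > \<epsilon> * real (2 * Suc k)}"
      by (auto simp: r_def pos_less_divide_eq simp del: mult_Suc_right)
    also have "distr M (count_space UNIV) (H (2 * Suc k)) = measure_pmf (random_matching_graph d (2 * Suc k))"
      by (rule assms(4)) auto
    finally show ?thesis .
  qed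
  have "AE \<omega> in M. \<forall>j. \<forall>\<^sub>F k in sequentially. \<omega> \<in> space M - A (1 / real (Suc j)) k"
  proof (subst AE_all_countable, rule allI)
    fix j
    show "AE \<omega> in M. \<forall>\<^sub>F k in sequentially. \<omega> \<in> space M - A (1 / real (Suc j)) k"
    proof (rule borel_cantelli_AE1[OF A_sets])
      show "summable (\<lambda>k. measure M (A (1 / real (Suc j)) k))"
        unfolding A_prob using assms(2) by (intro prob_rank_large_summable) auto
    qed (simp add: less_top[symmetric])
  qed
  then show ?thesis
  proof eventually_elim
    case (elim \<omega>)
    have "(\<lambda>k. r k (H (2 * Suc k) \<omega>)) \<longlonglongrightarrow> 0"
    proof (rule LIMSEQ_I)
      fix \<epsilon> :: real assume "\<epsilon> > 0"
      then obtain j where j: "1 / real (Suc j) < \<epsilon>" using nat_approx_posE by blast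
      from elim obtain K where K: "\<And>k. k \<ge> K \<Longrightarrow> \<omega> \<in> space M - A (1 / real (Suc j)) k"
        unfolding eventually_sequentially by blast
      have "norm (r k (H (2 * Suc k) \<omega>) - 0) < \<epsilon>" if "k \<ge> K" for k
      proof -
        have "r k (H (2 * Suc k) \<omega>) \<le> 1 / real (Suc j)" using K[OF that] by (auto simp: A_def)
        moreover have "r k (H (2 * Suc k) \<omega>) \<ge> 0" by (simp add: r_def)
        ultimately show ?thesis using j by simp
      qed
      then show "\<exists>K. \<forall>k\<ge>K. norm (r k (H (2 * Suc k) \<omega>) - 0) < \<epsilon>" by blast
    qed
    then show ?case
      unfolding r_def by (rule LIMSEQ_imp_Suc)
  qed
qed

end
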